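(* Consider the analyst's optimization problem for moment estimation with the Horvitz-Thompson estimator: given a cost distribution $\mathcal F$ with finite support $\mathcal C=\{c_1<\dots<c_{|\mathcal C|}\}\subset(0,\infty)$, $\pi_t=\Pr[c=c_t]>0$, and an average budget per agent $\bar B=B/n$ with $0<\bar B<\mathbb E[c]$, minimize the worst-case variance $\mathbb V^*(\hat\theta_S;\mathcal F,A)$ over monotone non-increasing allocation rules $A=(A_1,\dots,A_{|\mathcal C|})\in(0,1]^{|\mathcal C|}$ (so $A_t=A(c_t)$ and $A_1\ge\dots\ge A_{|\mathcal C|}$) subject to $\sum_t\pi_tc_tA_t\le\bar B$. The optimal allocation rule $A$ is determined by two constants $\bar A$ and $t^*\in\{0,\dots,|\mathcal C|\}$ such that $$A_t=\begin{cases}\bar A&\text{if }t\le t^*,\\ \dfrac{\alpha}{\sqrt{c_t}}&\text{otherwise},\end{cases}$$ with $\alpha$ uniquely determined such that the budget constraint is binding, i.e. (when $t^*<|\mathcal C|$, with $c_0=0$) $$\alpha=\frac{\bar B-\bar A\,\mathbb E[c\cdot 1\{c\le c_{t^*}\}]}{\mathbb E[\sqrt c\cdot 1\{c>c_{t^*}\}]}.$$ Moreover, the parameters $\bar A$ and $t^*$ can be computed in time $O(\log|\mathcal C|)$.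
   Context: Setting. There are $n$ agents; agent $i$ has a pair $(z_i,c_i)$ with data $z_i\in\mathcal Z$ and cost $c_i>0$, drawn i.i.d. from a distribution $\mathcal D$ on $\mathcal Z\times\mathcal C$. The marginal of costs is $\mathcal F$ (known); $\mathcal D$ is otherwise unknown, and $\mathcal D$ is called consistent with $\mathcal F$ if its cost marginal is $\mathcal F$. An allocation rule is a function $A:\mathcal C\to(0,1]$; given the costs, each agent $i$ is put in the sample $S$ with probability $A(c_i)$, independently of everything else (in particular of $z_i$ given $c_i$). There is a (measurable) moment function $m:\mathcal Z\to[0,1]$ which attains both values $0$ and $1$, and the parameter of interest is $\theta=\mathbb E[m(z)]$. The Horvitz-Thompson estimator is $$\hat\theta_S=\frac1n\sum_{i=1}^n\frac{m(z_i)\,1\{i\in S\}}{A(c_i)}.$$ $\mathbb V(\hat\theta_S;\mathcal D,A)$ denotes its variance, and the worst-case variance is $\mathbb V^*(\hat\theta_S;\mathcal F,A)=\sup\mathbb V(\hat\theta_S;\mathcal D,A)$, the supremum being over all $\mathcal D$ consistent with $\mathcal F$. Expectations $\mathbb E[g(c)]$ are over $c\sim\mathcal F$. Running time is counted as the number of steps of a search over the ordered support $c_1<\dots<c_{|\mathcal C|}$; no machine model is specified. *)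

theory Defs
  imports "HOL-Probability.Probability" "HOL-Library.Landau_Symbols"
begin

text \<open>
  The cost distribution is a finitely supported \<open>F :: real pmf\<close>; its support \<open>set_pmf F\<close>
  is the cost space. \<open>Z\<close> is the measurable data space. An allocation rule is a function
  \<open>A :: real \<Rightarrow> real\<close>, of which only the values on \<open>set_pmf F\<close> matter.
\<close>

definition moment_function :: "'z measure \<Rightarrow> ('z \<Rightarrow> real) \<Rightarrow> bool" where
  "moment_function Z m \<longleftrightarrow>
     m \<in> borel_measurable Z \<and> (\<forall>z\<in>space Z. 0 \<le> m z \<and> m z \<le> 1) \<and>
     (\<exists>z\<in>space Z. m z = 0) \<and> (\<exists>z\<in>space Z. m z = 1)"

definition consistent :: "'z measure \<Rightarrow> real pmf \<Rightarrow> ('z \<times> real) measure set" where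
  "consistent Z F =
     {D. prob_space D \<and> sets D = sets (Z \<Otimes>\<^sub>M count_space (set_pmf F)) \<and>
         distr D (count_space UNIV) snd = measure_pmf F}"

definition agent :: "('z \<times> real) measure \<Rightarrow> (real \<Rightarrow> real) \<Rightarrow> (('z \<times> real) \<times> bool) measure" where
  "agent D A =
     D \<bind> (\<lambda>(z, c). distr (measure_pmf (bernoulli_pmf (A c))) (D \<Otimes>\<^sub>M count_space UNIV)
                       (\<lambda>s. ((z, c), s)))"

definition agents :: "nat \<Rightarrow> ('z \<times> real) measure \<Rightarrow> (real \<Rightarrow> real) \<Rightarrow> (nat \<Rightarrow> ('z \<times> real) \<times> bool) measure" where
  "agents n D A = (\<Pi>\<^sub>M i\<in>{..<n}. agent D A)"

definition ht_estimator ::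
  "('z \<Rightarrow> real) \<Rightarrow> nat \<Rightarrow> (real \<Rightarrow> real) \<Rightarrow> (nat \<Rightarrow> 'z \<times> real) \<Rightarrow> nat set \<Rightarrow> real" where
  "ht_estimator m n A zc S =
     1 / real n * (\<Sum>i<n. m (fst (zc i)) * indicator S i / A (snd (zc i)))"

definition ht_variance ::
  "('z \<Rightarrow> real) \<Rightarrow> nat \<Rightarrow> ('z \<times> real) measure \<Rightarrow> (real \<Rightarrow> real) \<Rightarrow> real" where
  "ht_variance m n D A =
     prob_space.variance (agents n D A)
       (\<lambda>\<omega>. ht_estimator m n A (\<lambda>i. fst (\<omega> i)) {i. i < n \<and> snd (\<omega> i)})"

text \<open>
  The supremum is over a nonempty set, and bounded: for finite support and \<open>A\<close> positive on it, the
  variance is at most the reciprocal of the least value of \<open>A\<close> on the support.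
\<close>

definition worst_case_variance ::
  "'z measure \<Rightarrow> ('z \<Rightarrow> real) \<Rightarrow> nat \<Rightarrow> real pmf \<Rightarrow> (real \<Rightarrow> real) \<Rightarrow> real" where
  "worst_case_variance Z m n F A = (SUP D\<in>consistent Z F. ht_variance m n D A)"

definition feasible :: "real pmf \<Rightarrow> real \<Rightarrow> (real \<Rightarrow> real) \<Rightarrow> bool" where
  "feasible F Bbar A \<longleftrightarrow>
     (\<forall>c\<in>set_pmf F. 0 < A c \<and> A c \<le> 1) \<and> antimono_on (set_pmf F) A \<and>
     (\<Sum>c\<in>set_pmf F. pmf F c * c * A c) \<le> Bbar"

definition optimal_allocation ::
  "'z measure \<Rightarrow> ('z \<Rightarrow> real) \<Rightarrow> nat \<Rightarrow> real pmf \<Rightarrow> real \<Rightarrow> (real \<Rightarrow> real) \<Rightarrow> bool" where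
  "optimal_allocation Z m n F Bbar A \<longleftrightarrow>
     feasible F Bbar A \<and>
     (\<forall>A'. feasible F Bbar A' \<longrightarrow> worst_case_variance Z m n F A \<le> worst_case_variance Z m n F A')"

definition cost :: "real pmf \<Rightarrow> nat \<Rightarrow> real" where
  "cost F t = (if t = 0 then 0 else sorted_list_of_set (set_pmf F) ! (t - 1))"

definition head_cost :: "real pmf \<Rightarrow> nat \<Rightarrow> real" where
  "head_cost F t = measure_pmf.expectation F (\<lambda>c. c * indicator {..cost F t} c)"

definition tail_sqrt_cost :: "real pmf \<Rightarrow> nat \<Rightarrow> real" where
  "tail_sqrt_cost F t = measure_pmf.expectation F (\<lambda>c. sqrt c * indicator {cost F t<..} c)"

definition tail_prob :: "real pmf \<Rightarrow> nat \<Rightarrow> real" where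
  "tail_prob F t = measure_pmf.prob F {cost F t<..}"

definition threshold_rule :: "real pmf \<Rightarrow> real \<Rightarrow> nat \<Rightarrow> real \<Rightarrow> nat \<Rightarrow> real" where
  "threshold_rule F Abar tstar \<alpha> t = (if t \<le> tstar then Abar else \<alpha> / sqrt (cost F t))"

definition threshold_spend :: "real pmf \<Rightarrow> real \<Rightarrow> nat \<Rightarrow> real \<Rightarrow> real" where
  "threshold_spend F Abar tstar \<alpha> =
     (\<Sum>t = 1..card (set_pmf F). pmf F (cost F t) * cost F t * threshold_rule F Abar tstar \<alpha> t)"

text \<open>
  Running time is measured in algebraic decision trees. A tree knows the support size
  (a family of trees has one member for each size) and depends on the rest of the instance
  only through the budget and through single entries of the ordered table of costs and truncated
  moments. The truncated moments are part of the table because a sublinear search cannot sum over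
  the support. Every constant, table access, arithmetic operation and comparison costs one step.

  One of the operations is the least positive root of a cubic, since the stationarity
  condition for \<open>Abar\<close> at a fixed threshold is a cubic equation. The infimum below is that root
  whenever the cubic is not identically zero and has a positive root.
\<close>

datatype expr =
    Const nat
  | Budget
  | Cost nat
  | Tail_Prob nat
  | Head_Cost nat
  | Tail_Sqrt_Cost nat
  | Add expr expr
  | Sub expr expr
  | Mul expr expr
  | Div expr expr
  | Sqrt expr
  | Cubic_Root expr expr expr expr

primrec expr_val :: "real pmf \<Rightarrow> real \<Rightarrow> expr \<Rightarrow> real" where
  "expr_val F Bbar (Const k) = real k"
| "expr_val F Bbar Budget = Bbar"
| "expr_val F Bbar (Cost t) = cost F t"
| "expr_val F Bbar (Tail_Prob t) = tail_prob F t"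
| "expr_val F Bbar (Head_Cost t) = head_cost F t"
| "expr_val F Bbar (Tail_Sqrt_Cost t) = tail_sqrt_cost F t"
| "expr_val F Bbar (Add a b) = expr_val F Bbar a + expr_val F Bbar b"
| "expr_val F Bbar (Sub a b) = expr_val F Bbar a - expr_val F Bbar b"
| "expr_val F Bbar (Mul a b) = expr_val F Bbar a * expr_val F Bbar b"
| "expr_val F Bbar (Div a b) = expr_val F Bbar a / expr_val F Bbar b"
| "expr_val F Bbar (Sqrt a) = sqrt (expr_val F Bbar a)"
| "expr_val F Bbar (Cubic_Root a b c d) =
     Inf {x. 0 < x \<and> expr_val F Bbar a * x ^ 3 + expr_val F Bbar b * x ^ 2
                     + expr_val F Bbar c * x + expr_val F Bbar d = 0}"

primrec expr_steps :: "expr \<Rightarrow> nat" where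
  "expr_steps (Const k) = 1"
| "expr_steps Budget = 1"
| "expr_steps (Cost t) = 1"
| "expr_steps (Tail_Prob t) = 1"
| "expr_steps (Head_Cost t) = 1"
| "expr_steps (Tail_Sqrt_Cost t) = 1"
| "expr_steps (Add a b) = expr_steps a + expr_steps b + 1"
| "expr_steps (Sub a b) = expr_steps a + expr_steps b + 1"
| "expr_steps (Mul a b) = expr_steps a + expr_steps b + 1"
| "expr_steps (Div a b) = expr_steps a + expr_steps b + 1"
| "expr_steps (Sqrt a) = expr_steps a + 1"
| "expr_steps (Cubic_Root a b c d) = expr_steps a + expr_steps b + expr_steps c + expr_steps d + 1"

datatype search =
    Output expr nat
  | If_Le expr expr search search

primrec search_output :: "real pmf \<Rightarrow> real \<Rightarrow> search \<Rightarrow> real \<times> nat" where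
  "search_output F Bbar (Output e t) = (expr_val F Bbar e, t)"
| "search_output F Bbar (If_Le a b s1 s2) =
     (if expr_val F Bbar a \<le> expr_val F Bbar b
      then search_output F Bbar s1 else search_output F Bbar s2)"

primrec search_steps :: "real pmf \<Rightarrow> real \<Rightarrow> search \<Rightarrow> nat" where
  "search_steps F Bbar (Output e t) = expr_steps e + 1"
| "search_steps F Bbar (If_Le a b s1 s2) =
     expr_steps a + expr_steps b + 1 +
     (if expr_val F Bbar a \<le> expr_val F Bbar b
      then search_steps F Bbar s1 else search_steps F Bbar s2)"

end

theory Submission
  imports Defs
begin

text \<open>
  The variance is \<open>(E[m\<^sup>2 / A] - (E m)\<^sup>2) / n\<close>. Because \<open>m\<^sup>2 \<le> m\<close>, with equality for data concentrated
  on the values \<open>0\<close> and \<open>1\<close> of \<open>m\<close>, nature only chooses the conditional means \<open>q c\<close> of \<open>m\<close>, and the payoff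
  \<open>E[q / A] - (E q)\<^sup>2\<close> is concave in \<open>q\<close> and convex in \<open>A\<close>. It has a saddle point
  determined by a cutoff cost \<open>k\<close>: \<open>A\<close> is proportional to \<open>min 1 (sqrt (k / c))\<close> with top level
  \<open>a = min 1 (1 / (2 * E[min 1 (c / k)]))\<close>, and \<open>q c = min 1 (c / k)\<close> (moved towards \<open>1\<close> if \<open>a = 1\<close>).
  Strict convexity of \<open>1 / x\<close> makes the optimal rule unique. The budget spent is increasing
  in \<open>k\<close>, so the threshold is found by binary search among the costs, and
  the level at that threshold is the least positive root of a cubic, truncated at \<open>1\<close>.
\<close>


subsection \<open>Variance of the estimator\<close>

text \<open>After centring, the squared sum expands into products of pairs; the off-diagonal ones
  have mean zero by independence, so only the \<open>n\<close> diagonal terms survive.\<close>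

lemma (in prob_space) variance_iid_mean:
  fixes X :: "'a \<Rightarrow> real"
  assumes X[measurable]: "X \<in> borel_measurable M"
    and bound: "\<And>x. x \<in> space M \<Longrightarrow> \<bar>X x\<bar> \<le> b"
    and n: "0 < n"
  shows "prob_space.variance (\<Pi>\<^sub>M i\<in>{..<n::nat}. M) (\<lambda>\<omega>. 1 / real n * (\<Sum>i<n. X (\<omega> i)))
           = variance X / real n"
proof -
  let ?P = "\<Pi>\<^sub>M i\<in>{..<n}. M"
  interpret PP: prob_space ?P
    by (intro prob_space_PiM prob_space_axioms)
  interpret P: product_prob_space "\<lambda>_::nat. M" "{..<n}"
    by unfold_locales
  define \<mu> where "\<mu> = expectation X"
  define Y where "Y x = X x - \<mu>" for x
  have intX: "integrable M X"
    by (rule integrable_const_bound[of _ b]) (auto intro!: bound AE_I2)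
  have Ymeas[measurable]: "Y \<in> borel_measurable M"
    unfolding Y_def by measurable
  have Yb: "\<bar>Y x\<bar> \<le> b + \<bar>\<mu>\<bar>" if "x \<in> space M" for x
    using bound[OF that] unfolding Y_def by linarith
  have intY: "integrable M Y"
    by (rule integrable_const_bound[of _ "b + \<bar>\<mu>\<bar>"]) (auto intro!: Yb AE_I2)
  have EY: "expectation Y = 0"
    unfolding Y_def using intX by (simp add: \<mu>_def prob_space)
  have intYY: "integrable M (\<lambda>x. Y x * Y x)"
  proof (rule integrable_const_bound[of _ "(b + \<bar>\<mu>\<bar>) * (b + \<bar>\<mu>\<bar>)"])
    have "\<bar>Y x\<bar> * \<bar>Y x\<bar> \<le> (b + \<bar>\<mu>\<bar>) * (b + \<bar>\<mu>\<bar>)" if "x \<in> space M" for x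
      using Yb[OF that] by (intro mult_mono) auto
    then show "AE x in M. norm (Y x * Y x) \<le> (b + \<bar>\<mu>\<bar>) * (b + \<bar>\<mu>\<bar>)"
      by (intro AE_I2) (simp add: abs_mult)
  qed measurable
  have single: "PP.expectation (\<lambda>\<omega>. g (\<omega> i)) = expectation g"
    if "i < n" and g: "g \<in> borel_measurable M" for i and g :: "'a \<Rightarrow> real"
  proof -
    have "expectation g = integral\<^sup>L (distr ?P M (\<lambda>\<omega>. \<omega> i)) g"
      using P.PiM_component[of i] that by simp
    also have "\<dots> = PP.expectation (\<lambda>\<omega>. g (\<omega> i))"
      using that by (subst integral_distr) auto
    finally show ?thesis ..
  qed
  have Ycomp: "(\<lambda>\<omega>. Y (\<omega> i)) \<in> borel_measurable ?P" if "i < n" for i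
    using that by (intro measurable_compose[OF measurable_component_singleton[of i] Ymeas]) simp
  have pair: "PP.expectation (\<lambda>\<omega>. Y (\<omega> i) * Y (\<omega> j)) = (if i = j then variance X else 0)"
    if ij: "i < n" "j < n" for i j
  proof (cases "i = j")
    case True
    then show ?thesis
      using single[OF ij(1), of "\<lambda>x. Y x * Y x"] by (simp add: Y_def \<mu>_def power2_eq_square)
  next
    case False
    \<comment> \<open>The product formula wants a factor for every coordinate, hence the constant 1
      away from \<open>i\<close> and \<open>j\<close>; the factor at \<open>i\<close> has mean
      zero.\<close>
    define f where "f k = (if k = i \<or> k = j then Y else (\<lambda>_. 1))" for k
    have prod: "(\<lambda>\<omega>. Y (\<omega> i) * Y (\<omega> j)) = (\<lambda>\<omega>. \<Prod>k<n. f k (\<omega> k))"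
    proof
      fix \<omega>
      have "(\<Prod>k<n. f k (\<omega> k)) = (\<Prod>k\<in>{i, j}. f k (\<omega> k))"
        using ij by (intro prod.mono_neutral_right) (auto simp: f_def)
      then show "Y (\<omega> i) * Y (\<omega> j) = (\<Prod>k<n. f k (\<omega> k))"
        using False by (simp add: f_def)
    qed
    have "PP.expectation (\<lambda>\<omega>. Y (\<omega> i) * Y (\<omega> j)) = (\<Prod>k<n. expectation (f k))"
      unfolding prod
      by (rule P.product_integral_prod) (auto simp: f_def intY)
    also have "\<dots> = 0"
      using ij EY by (auto simp: prod_zero_iff f_def)
    finally show ?thesis
      using False by simp
  qed
  have intPY: "integrable ?P (\<lambda>\<omega>. Y (\<omega> i) * Y (\<omega> j))" if "i < n" "j < n" for i j
  proof (rule PP.integrable_const_bound[of _ "(b + \<bar>\<mu>\<bar>) * (b + \<bar>\<mu>\<bar>)"])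
    have "\<bar>Y (\<omega> i)\<bar> * \<bar>Y (\<omega> j)\<bar> \<le> (b + \<bar>\<mu>\<bar>) * (b + \<bar>\<mu>\<bar>)" if "\<omega> \<in> space ?P" for \<omega>
    proof (rule mult_mono)
      have "\<omega> i \<in> space M" "\<omega> j \<in> space M"
        using that \<open>i < n\<close> \<open>j < n\<close> by (auto simp: space_PiM PiE_iff)
      then show "\<bar>Y (\<omega> i)\<bar> \<le> b + \<bar>\<mu>\<bar>" "\<bar>Y (\<omega> j)\<bar> \<le> b + \<bar>\<mu>\<bar>" "0 \<le> b + \<bar>\<mu>\<bar>"
        using Yb[of "\<omega> i"] Yb[of "\<omega> j"] by auto
    qed simp
    then show "AE \<omega> in ?P. norm (Y (\<omega> i) * Y (\<omega> j)) \<le> (b + \<bar>\<mu>\<bar>) * (b + \<bar>\<mu>\<bar>)"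
      by (auto intro!: AE_I2 simp: abs_mult)
  qed (use Ycomp that in measurable)
  have intPX: "integrable ?P (\<lambda>\<omega>. X (\<omega> i))" if "i < n" for i
  proof (rule PP.integrable_const_bound[of _ b])
    show "AE \<omega> in ?P. norm (X (\<omega> i)) \<le> b"
      using bound that by (intro AE_I2) (auto simp: space_PiM PiE_iff)
    show "(\<lambda>\<omega>. X (\<omega> i)) \<in> borel_measurable ?P"
      using that by (intro measurable_compose[OF measurable_component_singleton[of i] X]) simp
  qed
  have mean: "PP.expectation (\<lambda>\<omega>. 1 / real n * (\<Sum>i<n. X (\<omega> i))) = \<mu>"
    using n intPX single[OF _ X] by (simp add: Bochner_Integration.integral_sum \<mu>_def)
  have dev: "(1 / real n * (\<Sum>i<n. X (\<omega> i)) - \<mu>)\<^sup>2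
      = 1 / (real n)\<^sup>2 * (\<Sum>i<n. \<Sum>j<n. Y (\<omega> i) * Y (\<omega> j))" for \<omega>
  proof -
    have "1 / real n * (\<Sum>i<n. X (\<omega> i)) - \<mu> = 1 / real n * (\<Sum>i<n. Y (\<omega> i))"
      using n by (simp add: Y_def sum_subtractf field_simps)
    then show ?thesis
      by (simp only: power_mult_distrib power_divide) (simp add: power2_eq_square sum_product)
  qed
  have "PP.variance (\<lambda>\<omega>. 1 / real n * (\<Sum>i<n. X (\<omega> i)))
      = 1 / (real n)\<^sup>2 * PP.expectation (\<lambda>\<omega>. \<Sum>i<n. \<Sum>j<n. Y (\<omega> i) * Y (\<omega> j))"
    unfolding mean dev by simp
  also have "PP.expectation (\<lambda>\<omega>. \<Sum>i<n. \<Sum>j<n. Y (\<omega> i) * Y (\<omega> j))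
      = (\<Sum>i<n. \<Sum>j<n. if i = j then variance X else 0)"
    using intPY pair
    by (subst Bochner_Integration.integral_sum)
      (auto simp: Bochner_Integration.integral_sum intro!: sum.cong Bochner_Integration.integrable_sum)
  also have "\<dots> = real n * variance X"
    by simp
  finally show ?thesis
    using n by (simp add: power2_eq_square)
qed

section \<open>The joint law of data, cost and selection of one agent\<close>

lemma consistentD:
  assumes "D \<in> consistent Z F"
  shows "prob_space D" "sets D = sets (Z \<Otimes>\<^sub>M count_space (set_pmf F))"
    "distr D (count_space UNIV) snd = measure_pmf F" "space D = space Z \<times> set_pmf F"
  using assms sets_eq_imp_space_eq[of D "Z \<Otimes>\<^sub>M count_space (set_pmf F)"]
  by (auto simp: consistent_def space_pair_measure)

text \<open>The cost coordinate carries the discrete sigma-algebra, so any \<open>A\<close> yields a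
  kernel. Landing in \<open>prob_algebra\<close> makes the bind in \<open>agent\<close> a
  probability measure.\<close>

lemma measurable_agent_kernel:
  assumes "D \<in> consistent Z F"
  shows "(\<lambda>x. distr (measure_pmf (bernoulli_pmf (A (snd x)))) (D \<Otimes>\<^sub>M count_space UNIV) (Pair x))
           \<in> D \<rightarrow>\<^sub>M prob_algebra (D \<Otimes>\<^sub>M count_space UNIV)"
proof -
  note [measurable_cong] = consistentD(2)[OF assms]
  have "(\<lambda>c. measure_pmf (bernoulli_pmf (A c))) \<in> count_space (set_pmf F) \<rightarrow>\<^sub>M prob_algebra (count_space UNIV)"
    by (auto simp: space_prob_algebra measure_pmf.prob_space_axioms)
  then have [measurable]: "(\<lambda>x. measure_pmf (bernoulli_pmf (A (snd x)))) \<in> D \<rightarrow>\<^sub>M prob_algebra (count_space UNIV)"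
    by (rule measurable_compose[rotated]) measurable
  show ?thesis
    by (rule measurable_distr_prob_space2[where M="count_space UNIV"]) measurable
qed

lemma agent_eq_bind:
  "agent D A = D \<bind>
     (\<lambda>x. distr (measure_pmf (bernoulli_pmf (A (snd x)))) (D \<Otimes>\<^sub>M count_space UNIV) (Pair x))"
  unfolding agent_def by (intro arg_cong[where f = "bind D"]) auto

lemma prob_space_agent:
  assumes "D \<in> consistent Z F"
  shows "prob_space (agent D A)" "sets (agent D A) = sets (D \<Otimes>\<^sub>M count_space UNIV)"
proof -
  have D: "D \<in> space (prob_algebra D)"
    using consistentD(1)[OF assms] by (simp add: space_prob_algebra)
  show "prob_space (agent D A)" "sets (agent D A) = sets (D \<Otimes>\<^sub>M count_space UNIV)"
    using prob_space_bind'[OF D measurable_agent_kernel[OF assms]]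
      sets_bind'[OF D measurable_agent_kernel[OF assms]]
    unfolding agent_eq_bind by blast+
qed

text \<open>Integration against a bind is iterated, and the inner integral over the selection bit
  has two terms. The bounds on \<open>A\<close> make \<open>A c\<close> the true success probability
  of \<open>bernoulli_pmf (A c)\<close>.\<close>

lemma integral_agent:
  assumes D: "D \<in> consistent Z F"
    and A: "\<And>c. c \<in> set_pmf F \<Longrightarrow> 0 < A c \<and> A c \<le> 1"
    and f: "f \<in> borel_measurable (D \<Otimes>\<^sub>M count_space UNIV)"
    and bound: "\<And>x. x \<in> space (D \<Otimes>\<^sub>M count_space UNIV) \<Longrightarrow> \<bar>f x\<bar> \<le> b"
  shows "integral\<^sup>L (agent D A) f
           = (\<integral>x. A (snd x) * f (x, True) + (1 - A (snd x)) * f (x, False) \<partial>D)"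
proof -
  let ?K = "\<lambda>x. distr (measure_pmf (bernoulli_pmf (A (snd x)))) (D \<Otimes>\<^sub>M count_space UNIV) (Pair x)"
  interpret prob_space D
    using consistentD(1)[OF D] .
  have K: "?K \<in> D \<rightarrow>\<^sub>M subprob_algebra (D \<Otimes>\<^sub>M count_space UNIV)"
    by (rule measurable_prob_algebraD[OF measurable_agent_kernel[OF D]])
  have "integral\<^sup>L (agent D A) f = integral\<^sup>L (D \<bind> ?K) f"
    unfolding agent_eq_bind ..
  also have "\<dots> = (\<integral>x. integral\<^sup>L (?K x) f \<partial>D)"
  proof (rule integral_bind[OF f bound K])
    show "AE x in D. emeasure (?K x) (space (?K x)) \<le> ennreal 1"
    proof (intro AE_I2)
      fix x assume "x \<in> space D"
      then have "prob_space (?K x)"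
        using measurable_space[OF measurable_agent_kernel[OF D, of A], of x] by (simp add: space_prob_algebra)
      then show "emeasure (?K x) (space (?K x)) \<le> ennreal 1"
        using prob_space.emeasure_space_1 by fastforce
    qed
  qed (assumption, rule finite_measure_axioms)
  also have "\<dots> = (\<integral>x. A (snd x) * f (x, True) + (1 - A (snd x)) * f (x, False) \<partial>D)"
  proof (rule Bochner_Integration.integral_cong[OF refl])
    fix x assume x: "x \<in> space D"
    then have "0 < A (snd x) \<and> A (snd x) \<le> 1"
      using A consistentD(4)[OF D] by auto
    moreover have "Pair x \<in> measure_pmf (bernoulli_pmf (A (snd x))) \<rightarrow>\<^sub>M D \<Otimes>\<^sub>M count_space UNIV"
      using x by (simp add: space_pair_measure)
    ultimately show "integral\<^sup>L (?K x) f = A (snd x) * f (x, True) + (1 - A (snd x)) * f (x, False)"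
      using f by (simp add: integral_distr)
  qed
  finally show ?thesis .
qed

text \<open>Selection with probability \<open>A c\<close> cancels the weight \<open>1 / A c\<close>
  in the mean of one summand, but only one of the two such weights in its second moment.\<close>

lemma ht_variance_eq:
  assumes D: "D \<in> consistent Z F" and fin: "finite (set_pmf F)"
    and A: "\<And>c. c \<in> set_pmf F \<Longrightarrow> 0 < A c \<and> A c \<le> 1"
    and m: "moment_function Z m" and n: "0 < n"
  shows "ht_variance m n D A
           = ((\<integral>x. (m (fst x))\<^sup>2 / A (snd x) \<partial>D) - (\<integral>x. m (fst x) \<partial>D)\<^sup>2) / real n"
proof -
  interpret D: prob_space D
    using consistentD(1)[OF D] .
  interpret prob_space "agent D A"
    using prob_space_agent(1)[OF D] .
  note [measurable_cong] = consistentD(2)[OF D]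
  have [measurable]: "m \<in> borel_measurable Z"
    using m by (simp add: moment_function_def)
  have m01: "0 \<le> m z" "m z \<le> 1" if "z \<in> space Z" for z
    using m that by (auto simp: moment_function_def)
  have "A \<in> borel_measurable (count_space (set_pmf F))"
    by simp
  then have [measurable]: "(\<lambda>x. A (snd x)) \<in> borel_measurable D"
    by (rule measurable_compose[rotated]) measurable
  have Apos: "A (snd x) \<noteq> 0" if "x \<in> space D" for x
  proof -
    have "snd x \<in> set_pmf F"
      using that unfolding consistentD(4)[OF D] by (simp add: mem_Times_iff)
    from A[OF this] show ?thesis
      by simp
  qed
  define X where "X x = m (fst (fst x)) * of_bool (snd x) / A (snd (fst x))" for x :: "('a \<times> real) \<times> bool"
  define b where "b = Max ((\<lambda>c. 1 / A c) ` set_pmf F)"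
  have b: "1 / A c \<le> b" if "c \<in> set_pmf F" for c
    using that fin by (auto simp: b_def)
  have Xm0[measurable]: "X \<in> borel_measurable (D \<Otimes>\<^sub>M count_space UNIV)"
    unfolding X_def by measurable
  have Xm: "X \<in> borel_measurable (agent D A)"
    using Xm0 measurable_cong_sets[OF prob_space_agent(2)[OF D] refl] by blast
  have Xb0: "\<bar>X x\<bar> \<le> b" if "x \<in> space (D \<Otimes>\<^sub>M count_space UNIV)" for x
  proof -
    have "fst x \<in> space D"
      using that by (auto simp: space_pair_measure)
    then have 1: "fst (fst x) \<in> space Z" and 2: "snd (fst x) \<in> set_pmf F"
      unfolding consistentD(4)[OF D] by (simp_all add: mem_Times_iff)
    have "\<bar>X x\<bar> \<le> 1 / A (snd (fst x))"
      using m01[OF 1] A[OF 2] by (cases "snd x") (simp_all add: X_def abs_mult divide_right_mono)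
    then show ?thesis
      using b[OF 2] by linarith
  qed
  have Xb: "\<bar>X x\<bar> \<le> b" if "x \<in> space (agent D A)" for x
    using Xb0 that sets_eq_imp_space_eq[OF prob_space_agent(2)[OF D]] by simp
  have EX: "expectation X = (\<integral>x. m (fst x) \<partial>D)"
  proof (subst integral_agent[OF D A Xm0 Xb0])
    show "(\<integral>x. A (snd x) * X (x, True) + (1 - A (snd x)) * X (x, False) \<partial>D) = (\<integral>x. m (fst x) \<partial>D)"
      using Apos by (intro Bochner_Integration.integral_cong refl) (simp_all add: X_def)
  qed
  have Xbb0: "\<bar>(X x)\<^sup>2\<bar> \<le> b\<^sup>2" if "x \<in> space (D \<Otimes>\<^sub>M count_space UNIV)" for x
    using power_mono[OF Xb0[OF that], of 2] by simp
  have EXX: "expectation (\<lambda>x. (X x)\<^sup>2) = (\<integral>x. (m (fst x))\<^sup>2 / A (snd x) \<partial>D)"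
  proof (subst integral_agent[OF D A _ Xbb0])
    show "(\<integral>x. A (snd x) * (X (x, True))\<^sup>2 + (1 - A (snd x)) * (X (x, False))\<^sup>2 \<partial>D)
        = (\<integral>x. (m (fst x))\<^sup>2 / A (snd x) \<partial>D)"
      using Apos by (intro Bochner_Integration.integral_cong refl) (simp_all add: X_def power2_eq_square)
  qed measurable
  have est: "ht_estimator m n A (\<lambda>i. fst (\<omega> i)) {i. i < n \<and> snd (\<omega> i)} = 1 / real n * (\<Sum>i<n. X (\<omega> i))"
    for \<omega>
    by (auto simp: ht_estimator_def X_def indicator_def intro!: sum.cong)
  have "ht_variance m n D A = variance X / real n"
    unfolding ht_variance_def agents_def est by (rule variance_iid_mean[OF Xm Xb n])
  also have "variance X = expectation (\<lambda>x. (X x)\<^sup>2) - (expectation X)\<^sup>2"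
  proof (rule variance_eq)
    show "integrable (agent D A) X"
      using Xb Xm by (intro integrable_const_bound[of _ b]) auto
    show "integrable (agent D A) (\<lambda>x. (X x)\<^sup>2)"
      using power_mono[OF Xb, of _ 2] Xm by (intro integrable_const_bound[of _ "b\<^sup>2"]) auto
  qed
  finally show ?thesis
    unfolding EX EXX .
qed


subsection \<open>Worst-case variance\<close>

lemma integral_cost:
  fixes g :: "real \<Rightarrow> real"
  assumes D: "D \<in> consistent Z F" and fin: "finite (set_pmf F)"
  shows "(\<integral>x. g (snd x) \<partial>D) = (\<Sum>c\<in>set_pmf F. pmf F c * g c)"
proof -
  note [measurable_cong] = consistentD(2)[OF D]
  have "(\<lambda>c. c) \<in> count_space (set_pmf F) \<rightarrow>\<^sub>M count_space UNIV"
    by simp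
  then have "snd \<in> D \<rightarrow>\<^sub>M count_space UNIV"
    by (rule measurable_compose[rotated]) measurable
  then have "(\<integral>x. g (snd x) \<partial>D) = integral\<^sup>L (distr D (count_space UNIV) snd) g"
    by (subst integral_distr) auto
  also have "\<dots> = (\<Sum>c\<in>set_pmf F. pmf F c * g c)"
    unfolding consistentD(3)[OF D]
    by (subst integral_measure_pmf_real[OF fin]) (auto simp: mult.commute)
  finally show ?thesis .
qed

text \<open>
  Since \<open>m\<^sup>2 \<le> m\<close> and \<open>- x\<^sup>2 \<le> T\<^sup>2 - 2 * T * x\<close>, the variance is bounded by an expression
  that is linear in \<open>m\<close>, and its coefficients \<open>1 / A c - 2 * T\<close> are nonnegative.
\<close>

lemma ht_variance_le:
  assumes D: "D \<in> consistent Z F" and fin: "finite (set_pmf F)"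
    and A: "\<And>c. c \<in> set_pmf F \<Longrightarrow> 0 < A c \<and> A c \<le> 1"
    and m: "moment_function Z m" and n: "0 < n"
    and T: "\<And>c. c \<in> set_pmf F \<Longrightarrow> 2 * T \<le> 1 / A c"
  shows "ht_variance m n D A \<le> ((\<Sum>c\<in>set_pmf F. pmf F c * (1 / A c - 2 * T)) + T\<^sup>2) / real n"
proof -
  interpret prob_space D
    using consistentD(1)[OF D] .
  note [measurable_cong] = consistentD(2)[OF D]
  have [measurable]: "m \<in> borel_measurable Z"
    using m by (simp add: moment_function_def)
  have "A \<in> borel_measurable (count_space (set_pmf F))"
    by simp
  then have [measurable]: "(\<lambda>x. A (snd x)) \<in> borel_measurable D"
    by (rule measurable_compose[rotated]) measurable
  have m01: "0 \<le> m (fst x)" "m (fst x) \<le> 1" and C: "snd x \<in> set_pmf F" if "x \<in> space D" for x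
    using m that unfolding consistentD(4)[OF D] by (auto simp: moment_function_def)
  define b where "b = Max ((\<lambda>c. 1 / A c) ` set_pmf F)"
  have b: "0 < A (snd x)" "1 / A (snd x) \<le> b" if "x \<in> space D" for x
    using C[OF that] A fin by (auto simp: b_def)
  have i1: "integrable D (\<lambda>x. m (fst x))"
    using m01 by (intro integrable_const_bound[of _ 1]) auto
  have i2: "integrable D (\<lambda>x. 1 / A (snd x))"
    using b by (intro integrable_const_bound[of _ b]) (auto intro!: AE_I2 simp: less_imp_le)
  have i3: "integrable D (\<lambda>x. (m (fst x))\<^sup>2 / A (snd x))"
  proof (rule Bochner_Integration.integrable_bound[OF i2])
    show "AE x in D. norm ((m (fst x))\<^sup>2 / A (snd x)) \<le> norm (1 / A (snd x))"
      using m01 b(1) by (intro AE_I2) (auto intro!: divide_right_mono simp: power_le_one less_imp_le)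
  qed measurable
  let ?e = "\<integral>x. m (fst x) \<partial>D"
  have "(\<integral>x. (m (fst x))\<^sup>2 / A (snd x) \<partial>D) - ?e\<^sup>2 \<le> (\<integral>x. (m (fst x))\<^sup>2 / A (snd x) \<partial>D) - 2 * T * ?e + T\<^sup>2"
    using zero_le_power2[of "?e - T"] by (simp add: power2_diff algebra_simps)
  also have "\<dots> = (\<integral>x. (m (fst x))\<^sup>2 / A (snd x) - 2 * T * m (fst x) \<partial>D) + T\<^sup>2"
    using i1 i3 by simp
  also have "(\<integral>x. (m (fst x))\<^sup>2 / A (snd x) - 2 * T * m (fst x) \<partial>D) \<le> (\<integral>x. 1 / A (snd x) - 2 * T \<partial>D)"
  proof (rule integral_mono)
    fix x assume x: "x \<in> space D"
    let ?u = "m (fst x)" and ?v = "1 / A (snd x)"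
    have "?u\<^sup>2 * ?v - 2 * T * ?u \<le> ?u * ?v - 2 * T * ?u"
      using m01[OF x] b(1)[OF x]
      by (intro diff_right_mono mult_right_mono) (auto simp: power2_eq_square mult_left_le)
    also have "\<dots> = ?u * (?v - 2 * T)"
      by (simp add: algebra_simps)
    also have "\<dots> \<le> 1 * (?v - 2 * T)"
      using m01[OF x] T[OF C[OF x]] by (intro mult_right_mono) auto
    finally show "?u\<^sup>2 / A (snd x) - 2 * T * ?u \<le> ?v - 2 * T"
      by simp
  qed (use i1 i2 i3 in auto)
  also have "(\<integral>x. 1 / A (snd x) - 2 * T \<partial>D) = (\<Sum>c\<in>set_pmf F. pmf F c * (1 / A c - 2 * T))"
    using integral_cost[OF D fin, of "\<lambda>c. 1 / A c - 2 * T"] .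
  finally show ?thesis
    by (subst ht_variance_eq[OF D fin A m n]) (simp_all add: divide_right_mono)
qed

text \<open>The witness draws a cost \<open>c\<close> from \<open>F\<close>, then \<open>z1\<close>
  with probability \<open>q c\<close> and \<open>z0\<close> otherwise. As \<open>m\<close> is 0 or 1
  at these points, \<open>m\<close> and its square have the same conditional mean
  \<open>q c\<close>.\<close>

lemma ht_variance_attained:
  assumes fin: "finite (set_pmf F)"
    and A: "\<And>c. c \<in> set_pmf F \<Longrightarrow> 0 < A c \<and> A c \<le> 1"
    and q: "\<And>c. c \<in> set_pmf F \<Longrightarrow> 0 \<le> q c \<and> q c \<le> 1"
    and m: "moment_function Z m" and n: "0 < n"
  obtains D where "D \<in> consistent Z F"
    "ht_variance m n D A
       = ((\<Sum>c\<in>set_pmf F. pmf F c * (q c / A c)) - (\<Sum>c\<in>set_pmf F. pmf F c * q c)\<^sup>2) / real n"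
proof -
  obtain z0 z1 where z: "z0 \<in> space Z" "m z0 = 0" "z1 \<in> space Z" "m z1 = 1"
    using m by (auto simp: moment_function_def)
  obtain c0 where c0: "c0 \<in> set_pmf F"
    using set_pmf_not_empty[of F] by blast
  define p where "p = F \<bind> (\<lambda>c. map_pmf (\<lambda>b. (b, c)) (bernoulli_pmf (q c)))"
  \<comment> \<open>\<open>measure_pmf p\<close> lives on the full type, so costs off the support, a
    null set, are redirected to \<open>c0\<close> to make \<open>g\<close> map into the space of
    \<open>?Q\<close>.\<close>
  define r where "r c = (if c \<in> set_pmf F then c else c0)" for c
  define g where "g y = (if fst y then z1 else z0, r (snd y))" for y :: "bool \<times> real"
  let ?Q = "Z \<Otimes>\<^sub>M count_space (set_pmf F)"
  define D where "D = distr (measure_pmf p) ?Q g"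
  have g[measurable]: "g \<in> measure_pmf p \<rightarrow>\<^sub>M ?Q"
    using z c0 by (auto simp: g_def r_def space_pair_measure)
  have snd_p: "map_pmf snd p = F"
    by (simp add: p_def map_bind_pmf pmf.map_comp o_def map_pmf_const bind_return_pmf')
  have set_p: "snd y \<in> set_pmf F" if "y \<in> set_pmf p" for y
    using that by (auto simp: p_def)
  have D: "D \<in> consistent Z F"
    unfolding consistent_def
  proof (intro CollectI conjI)
    show "prob_space D"
      unfolding D_def by (rule measure_pmf.prob_space_distr[OF g])
    show "sets D = sets ?Q"
      by (simp add: D_def)
    have "(\<lambda>c. c) \<in> count_space (set_pmf F) \<rightarrow>\<^sub>M count_space UNIV"
      by simp
    then have snd: "snd \<in> ?Q \<rightarrow>\<^sub>M count_space UNIV"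
      by (rule measurable_compose[rotated]) measurable
    have "distr D (count_space UNIV) snd = distr (measure_pmf p) (count_space UNIV) (snd \<circ> g)"
      unfolding D_def by (rule distr_distr[OF snd g])
    also have "\<dots> = measure_pmf (map_pmf (snd \<circ> g) p)"
      by (simp add: map_pmf_rep_eq)
    also have "map_pmf (snd \<circ> g) p = map_pmf snd p"
      using set_p by (intro map_pmf_cong) (auto simp: g_def r_def)
    finally show "distr D (count_space UNIV) snd = measure_pmf F"
      by (simp add: snd_p)
  qed
  have [measurable]: "m \<in> borel_measurable Z"
    using m by (simp add: moment_function_def)
  have "A \<in> borel_measurable (count_space (set_pmf F))"
    by simp
  then have [measurable]: "(\<lambda>x. A (snd x)) \<in> borel_measurable ?Q"
    by (rule measurable_compose[rotated]) measurable
  have integral_D: "integral\<^sup>L D f = (\<Sum>c\<in>set_pmf F. pmf F c * (f (z1, c) * q c + f (z0, c) * (1 - q c)))"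
    if "f \<in> borel_measurable ?Q" for f :: "_ \<Rightarrow> real"
  proof -
    have "integral\<^sup>L D f = measure_pmf.expectation p (\<lambda>y. f (g y))"
      unfolding D_def by (rule integral_distr[OF g that])
    also have "\<dots> = (\<Sum>c\<in>set_pmf F. pmf F c *\<^sub>R
        measure_pmf.expectation (map_pmf (\<lambda>b. (b, c)) (bernoulli_pmf (q c))) (\<lambda>y. f (g y)))"
      unfolding p_def using fin by (intro pmf_expectation_bind) auto
    also have "\<dots> = (\<Sum>c\<in>set_pmf F. pmf F c * (f (z1, c) * q c + f (z0, c) * (1 - q c)))"
      using q by (intro sum.cong refl) (simp add: g_def r_def)
    finally show ?thesis .
  qed
  have "ht_variance m n D A
      = ((\<Sum>c\<in>set_pmf F. pmf F c * (q c / A c)) - (\<Sum>c\<in>set_pmf F. pmf F c * q c)\<^sup>2) / real n"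
    by (subst ht_variance_eq[OF D fin A m n]) (simp_all add: integral_D z)
  with D show ?thesis
    by (rule that)
qed

text \<open>The choice \<open>T = 0\<close> in \<open>ht_variance_le\<close> bounds all variances at
  once, so that the real \<open>SUP\<close> is a genuine least upper bound.\<close>

lemma bdd_above_ht_variance:
  assumes fin: "finite (set_pmf F)"
    and A: "\<And>c. c \<in> set_pmf F \<Longrightarrow> 0 < A c \<and> A c \<le> 1"
    and m: "moment_function Z m" and n: "0 < n"
  shows "bdd_above ((\<lambda>D. ht_variance m n D A) ` consistent Z F)"
proof (rule bdd_aboveI2)
  fix D assume "D \<in> consistent Z F"
  then show "ht_variance m n D A \<le> ((\<Sum>c\<in>set_pmf F. pmf F c * (1 / A c - 2 * 0)) + 0\<^sup>2) / real n"
    by (rule ht_variance_le[OF _ fin A m n]) (use A in \<open>auto simp: less_imp_le\<close>)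
qed

lemma worst_case_variance_le:
  assumes fin: "finite (set_pmf F)"
    and A: "\<And>c. c \<in> set_pmf F \<Longrightarrow> 0 < A c \<and> A c \<le> 1"
    and m: "moment_function Z m" and n: "0 < n"
    and T: "\<And>c. c \<in> set_pmf F \<Longrightarrow> 2 * T \<le> 1 / A c"
  shows "worst_case_variance Z m n F A \<le> ((\<Sum>c\<in>set_pmf F. pmf F c * (1 / A c - 2 * T)) + T\<^sup>2) / real n"
  unfolding worst_case_variance_def
proof (rule cSUP_least)
  obtain D where "D \<in> consistent Z F"
    by (rule ht_variance_attained[OF fin A _ m n, where q = "\<lambda>_. 0"]) auto
  then show "consistent Z F \<noteq> {}"
    by blast
qed (rule ht_variance_le[OF _ fin A m n T])

lemma le_worst_case_variance:
  assumes fin: "finite (set_pmf F)"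
    and A: "\<And>c. c \<in> set_pmf F \<Longrightarrow> 0 < A c \<and> A c \<le> 1"
    and q: "\<And>c. c \<in> set_pmf F \<Longrightarrow> 0 \<le> q c \<and> q c \<le> 1"
    and m: "moment_function Z m" and n: "0 < n"
  shows "((\<Sum>c\<in>set_pmf F. pmf F c * (q c / A c)) - (\<Sum>c\<in>set_pmf F. pmf F c * q c)\<^sup>2) / real n
           \<le> worst_case_variance Z m n F A"
proof -
  obtain D where "D \<in> consistent Z F" and eq: "ht_variance m n D A
      = ((\<Sum>c\<in>set_pmf F. pmf F c * (q c / A c)) - (\<Sum>c\<in>set_pmf F. pmf F c * q c)\<^sup>2) / real n"
    by (rule ht_variance_attained[OF fin A q m n])
  then show ?thesis
    unfolding worst_case_variance_def eq[symmetric]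
    by (intro cSUP_upper bdd_above_ht_variance[OF fin A m n])
qed


subsection \<open>Saddle points\<close>

text \<open>The gap between \<open>q / y\<close> and its tangent at \<open>x\<close> is
  \<open>q * (y - x)\<^sup>2 / (x\<^sup>2 * y)\<close>. That it vanishes only at
  \<open>y = x\<close> later gives uniqueness of the optimal rule.\<close>

lemma reciprocal_tangent:
  fixes q x y :: real
  assumes "0 < q" "0 < x" "0 < y"
  shows "q / x - q / x\<^sup>2 * (y - x) \<le> q / y"
    and "q / x - q / x\<^sup>2 * (y - x) = q / y \<Longrightarrow> y = x"
proof -
  have "q / y - (q / x - q / x\<^sup>2 * (y - x)) = q * (y - x)\<^sup>2 / (x\<^sup>2 * y)"
    using assms by (simp add: field_simps power2_eq_square)
  moreover have "0 \<le> q * (y - x)\<^sup>2 / (x\<^sup>2 * y)"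
    using assms by simp
  moreover have "q * (y - x)\<^sup>2 / (x\<^sup>2 * y) = 0 \<Longrightarrow> y = x"
    using assms by simp
  ultimately show "q / x - q / x\<^sup>2 * (y - x) \<le> q / y"
    "q / x - q / x\<^sup>2 * (y - x) = q / y \<Longrightarrow> y = x"
    by linarith+
qed

text \<open>
  The conditions say that \<open>(q, A0)\<close> is a saddle point of
  \<open>\<Sum>c. pmf F c * q c / A c - (\<Sum>c. pmf F c * q c)\<^sup>2\<close>, where \<open>q c\<close> stands for the mean of \<open>m\<close>
  given cost \<open>c\<close> and \<open>\<mu>\<close> is the multiplier of the budget constraint.
\<close>

lemma saddle_point_optimal:
  assumes fin: "finite (set_pmf F)" and m: "moment_function Z m" and n: "0 < n"
    and feas: "feasible F Bbar A0"
    and budget: "(\<Sum>c\<in>set_pmf F. pmf F c * c * A0 c) = Bbar"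
    and q: "\<And>c. c \<in> set_pmf F \<Longrightarrow> 0 < q c \<and> q c \<le> 1"
    and T: "(\<Sum>c\<in>set_pmf F. pmf F c * q c) = T"
    and nature: "\<And>c. c \<in> set_pmf F \<Longrightarrow> 2 * T \<le> 1 / A0 c \<and> (q c = 1 \<or> 2 * T = 1 / A0 c)"
    and analyst: "\<And>c. c \<in> set_pmf F \<Longrightarrow> \<mu> * c \<le> q c / (A0 c)\<^sup>2 \<and> (A0 c = 1 \<or> \<mu> * c = q c / (A0 c)\<^sup>2)"
    and \<mu>: "0 \<le> \<mu>"
  shows "optimal_allocation Z m n F Bbar A \<longleftrightarrow> (\<forall>c\<in>set_pmf F. A c = A0 c)"
proof -
  let ?C = "set_pmf F"
  define v where "v = (\<Sum>c\<in>?C. pmf F c * (q c / A0 c))"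
  have A0: "0 < A0 c \<and> A0 c \<le> 1" if "c \<in> ?C" for c
    using feas that by (simp add: feasible_def)
  have pos: "0 < pmf F c" if "c \<in> ?C" for c
    using that by (simp add: pmf_positive)
  have upper: "worst_case_variance Z m n F A' \<le> (v - T\<^sup>2) / n" if eq: "\<forall>c\<in>?C. A' c = A0 c" for A'
  proof -
    have "worst_case_variance Z m n F A' \<le> ((\<Sum>c\<in>?C. pmf F c * (1 / A' c - 2 * T)) + T\<^sup>2) / real n"
      using eq A0 nature by (intro worst_case_variance_le[OF fin _ m n]) auto
    also have "(\<Sum>c\<in>?C. pmf F c * (1 / A' c - 2 * T)) = (\<Sum>c\<in>?C. pmf F c * (q c / A0 c) - 2 * T * (pmf F c * q c))"
    proof (intro sum.cong refl)
      fix c assume c: "c \<in> ?C"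
      \<comment> \<open>Complementary slackness: either \<open>q c = 1\<close> or
        \<open>1 / A0 c - 2 * T\<close> vanishes, so inserting the factor \<open>q c\<close> changes
        nothing.\<close>
      have "pmf F c * (1 / A0 c - 2 * T) = pmf F c * ((1 / A0 c - 2 * T) * q c)"
        using nature[OF c] by auto
      then show "pmf F c * (1 / A' c - 2 * T) = pmf F c * (q c / A0 c) - 2 * T * (pmf F c * q c)"
        using eq c by (simp add: algebra_simps)
    qed
    also have "\<dots> = v - 2 * T * T"
      by (simp add: sum_subtractf v_def T flip: sum_distrib_left)
    finally show ?thesis
      by (simp add: power2_eq_square)
  qed
  \<comment> \<open>No feasible direction lowers the linearised payoff: \<open>A0\<close> exhausts
    the budget, \<open>A'\<close> cannot exceed it, and where \<open>A0 c = 1\<close> the inequality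
    in \<open>analyst\<close> suffices because \<open>A' c \<le> 1\<close>.\<close>
  have gain: "0 \<le> (\<Sum>c\<in>?C. pmf F c * (q c / (A0 c)\<^sup>2 * (A0 c - A' c)))"
    if A': "feasible F Bbar A'" for A'
  proof -
    have "0 \<le> \<mu> * ((\<Sum>c\<in>?C. pmf F c * c * A0 c) - (\<Sum>c\<in>?C. pmf F c * c * A' c))"
      using A' budget \<mu> by (simp add: feasible_def)
    also have "\<dots> = (\<Sum>c\<in>?C. pmf F c * (\<mu> * c * (A0 c - A' c)))"
      by (simp add: sum_distrib_left algebra_simps flip: sum_subtractf)
    also have "\<dots> \<le> (\<Sum>c\<in>?C. pmf F c * (q c / (A0 c)\<^sup>2 * (A0 c - A' c)))"
    proof (intro sum_mono mult_left_mono)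
      fix c assume c: "c \<in> ?C"
      show "\<mu> * c * (A0 c - A' c) \<le> q c / (A0 c)\<^sup>2 * (A0 c - A' c)"
      proof (cases "A0 c = 1")
        case True
        then have "0 \<le> A0 c - A' c"
          using A' c by (simp add: feasible_def)
        then show ?thesis
          using analyst[OF c] by (intro mult_right_mono) auto
      next
        case False
        then show ?thesis
          using analyst[OF c] by simp
      qed
    qed simp
    finally show ?thesis .
  qed
  have tangent: "v \<le> (\<Sum>c\<in>?C. pmf F c * (q c / A0 c - q c / (A0 c)\<^sup>2 * (A' c - A0 c)))"
    if A': "feasible F Bbar A'" for A'
  proof -
    have lin: "p * u + p * (e * (x - y)) = p * (u - e * (y - x))" for p u e x y :: real
      by (simp add: algebra_simps)
    have "v \<le> v + (\<Sum>c\<in>?C. pmf F c * (q c / (A0 c)\<^sup>2 * (A0 c - A' c)))"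
      using gain[OF A'] by simp
    also have "\<dots> = (\<Sum>c\<in>?C. pmf F c * (q c / A0 c - q c / (A0 c)\<^sup>2 * (A' c - A0 c)))"
      unfolding v_def sum.distrib[symmetric] by (intro sum.cong refl lin)
    finally show ?thesis .
  qed
  have tangent_le: "pmf F c * (q c / A0 c - q c / (A0 c)\<^sup>2 * (A' c - A0 c)) \<le> pmf F c * (q c / A' c)"
    if "feasible F Bbar A'" "c \<in> ?C" for A' c
    using that q A0 by (intro mult_left_mono reciprocal_tangent) (auto simp: feasible_def)
  have lower: "((\<Sum>c\<in>?C. pmf F c * (q c / A' c)) - T\<^sup>2) / n \<le> worst_case_variance Z m n F A'"
    if A': "feasible F Bbar A'" for A'
    using le_worst_case_variance[OF fin _ _ m n, of A' q] A' q
    by (simp add: feasible_def T less_imp_le)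
  have v_le: "(v - T\<^sup>2) / n \<le> worst_case_variance Z m n F A'" if A': "feasible F Bbar A'" for A'
  proof -
    have "v \<le> (\<Sum>c\<in>?C. pmf F c * (q c / A' c))"
      using tangent[OF A'] sum_mono[OF tangent_le[OF A']] by (rule order_trans)
    then have "(v - T\<^sup>2) / n \<le> ((\<Sum>c\<in>?C. pmf F c * (q c / A' c)) - T\<^sup>2) / n"
      by (simp add: divide_right_mono)
    then show ?thesis
      using lower[OF A'] by (rule order_trans)
  qed
  show ?thesis
  proof
    assume opt: "optimal_allocation Z m n F Bbar A"
    then have A: "feasible F Bbar A"
      by (simp add: optimal_allocation_def)
    have "worst_case_variance Z m n F A \<le> worst_case_variance Z m n F A0"
      using opt feas by (simp add: optimal_allocation_def)
    then have "((\<Sum>c\<in>?C. pmf F c * (q c / A c)) - T\<^sup>2) / n \<le> (v - T\<^sup>2) / n"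
      using lower[OF A] upper[of A0] by simp
    then have "(\<Sum>c\<in>?C. pmf F c * (q c / A c)) \<le> v"
      using n by (simp add: divide_le_cancel)
    \<comment> \<open>The chain from \<open>v\<close> through the tangents to the payoff of
      \<open>A\<close> closes up at \<open>v\<close>; termwise inequalities with equal sums are then
      termwise equalities.\<close>
    then have eq: "(\<Sum>c\<in>?C. pmf F c * (q c / A0 c - q c / (A0 c)\<^sup>2 * (A c - A0 c)))
        = (\<Sum>c\<in>?C. pmf F c * (q c / A c))"
      using tangent[OF A] sum_mono[OF tangent_le[OF A]] by (intro antisym) auto
    show "\<forall>c\<in>?C. A c = A0 c"
    proof
      fix c assume c: "c \<in> ?C"
      have "pmf F c * (q c / A0 c - q c / (A0 c)\<^sup>2 * (A c - A0 c)) = pmf F c * (q c / A c)"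
        using sum_mono_inv[OF eq tangent_le[OF A] c fin] .
      then have "q c / A0 c - q c / (A0 c)\<^sup>2 * (A c - A0 c) = q c / A c"
        by (rule mult_left_cancel[THEN iffD1, rotated]) (use pos[OF c] in simp)
      moreover have "0 < q c" "0 < A0 c" "0 < A c"
        using q[OF c] A0[OF c] A c by (simp_all add: feasible_def)
      ultimately show "A c = A0 c"
        using reciprocal_tangent(2)[of "q c" "A0 c" "A c"] by blast
    qed
  next
    assume eq: "\<forall>c\<in>?C. A c = A0 c"
    have "feasible F Bbar A"
      using feas eq by (simp add: feasible_def monotone_on_def)
    then show "optimal_allocation Z m n F Bbar A"
      using upper[OF eq] v_le by (auto simp: optimal_allocation_def intro: order_trans)
  qed
qed


subsection \<open>The ordered cost table\<close>

text \<open>Positions start at 1 because \<open>cost F 0 = 0\<close> is a sentinel, hence the index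
  shift. This converts sums over positions into sums over the support.\<close>

lemma bij_betw_cost:
  assumes "finite (set_pmf F)"
  shows "bij_betw (cost F) {1..card (set_pmf F)} (set_pmf F)"
proof -
  let ?xs = "sorted_list_of_set (set_pmf F)"
  have "bij_betw (\<lambda>t. t - 1) {1..card (set_pmf F)} {..<card (set_pmf F)}"
    by (rule bij_betwI[where g = Suc]) auto
  moreover have "bij_betw ((!) ?xs) {..<card (set_pmf F)} (set_pmf F)"
    using assms by (intro bij_betw_nth) auto
  ultimately have "bij_betw ((!) ?xs \<circ> (\<lambda>t. t - 1)) {1..card (set_pmf F)} (set_pmf F)"
    by (rule bij_betw_trans)
  then show ?thesis
    by (rule bij_betw_cong[THEN iffD1, rotated]) (auto simp: cost_def)
qed

lemma cost_in_support:
  assumes "finite (set_pmf F)" "1 \<le> t" "t \<le> card (set_pmf F)"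
  shows "cost F t \<in> set_pmf F"
  using bij_betw_cost[OF assms(1)] assms by (auto simp: bij_betw_def)

lemma cost_less:
  assumes fin: "finite (set_pmf F)" and pos: "set_pmf F \<subseteq> {0<..}"
    and "s < t" "t \<le> card (set_pmf F)"
  shows "cost F s < cost F t"
proof (cases "s = 0")
  case True
  then show ?thesis
    using cost_in_support[OF fin, of t] pos assms by (auto simp: cost_def)
next
  case False
  then show ?thesis
    using assms strict_sorted_list_of_set[of "set_pmf F"]
    by (auto simp: cost_def sorted_wrt_iff_nth_less)
qed

lemma cost_le_iff:
  assumes "finite (set_pmf F)" "set_pmf F \<subseteq> {0<..}" "s \<le> card (set_pmf F)" "t \<le> card (set_pmf F)"
  shows "cost F s \<le> cost F t \<longleftrightarrow> s \<le> t"
  using cost_less[OF assms(1,2), of s t] cost_less[OF assms(1,2), of t s] assms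
  by (cases s t rule: linorder_cases) auto

lemma expectation_eq_sum:
  fixes g :: "real \<Rightarrow> real"
  assumes "finite (set_pmf F)"
  shows "measure_pmf.expectation F g = (\<Sum>c\<in>set_pmf F. pmf F c * g c)"
  by (subst integral_measure_pmf_real[OF assms]) (auto simp: mult.commute)

lemma head_cost_eq:
  "finite (set_pmf F) \<Longrightarrow> head_cost F t = (\<Sum>c\<in>set_pmf F. pmf F c * (if c \<le> cost F t then c else 0))"
  by (auto simp: head_cost_def expectation_eq_sum indicator_def intro!: sum.cong)

lemma tail_sqrt_cost_eq:
  "finite (set_pmf F) \<Longrightarrow>
     tail_sqrt_cost F t = (\<Sum>c\<in>set_pmf F. pmf F c * (if c \<le> cost F t then 0 else sqrt c))"
  by (auto simp: tail_sqrt_cost_def expectation_eq_sum indicator_def intro!: sum.cong)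

lemma tail_prob_eq:
  assumes "finite (set_pmf F)"
  shows "tail_prob F t = (\<Sum>c\<in>set_pmf F. pmf F c * (if c \<le> cost F t then 0 else 1))"
proof -
  have "tail_prob F t = measure_pmf.expectation F (indicator {cost F t<..})"
    by (simp add: tail_prob_def)
  also have "\<dots> = (\<Sum>c\<in>set_pmf F. pmf F c * (if c \<le> cost F t then 0 else 1))"
    unfolding expectation_eq_sum[OF assms] by (intro sum.cong) (auto simp: indicator_def)
  finally show ?thesis .
qed

text \<open>Beyond the threshold \<open>c * (\<alpha> / sqrt c) = \<alpha> * sqrt c\<close>, so
  spending is linear in \<open>a\<close> and \<open>\<alpha>\<close>; a binding budget thus
  determines \<open>\<alpha>\<close> when the tail is nonempty.\<close>

lemma cost_rule_spend:
  assumes fin: "finite (set_pmf F)" and pos: "set_pmf F \<subseteq> {0<..}"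
  shows "(\<Sum>c\<in>set_pmf F. pmf F c * c * (if c \<le> cost F s then a else \<alpha> / sqrt c))
           = a * head_cost F s + \<alpha> * tail_sqrt_cost F s"
proof -
  have "pmf F c * c * (if c \<le> cost F s then a else \<alpha> / sqrt c)
      = a * (pmf F c * (if c \<le> cost F s then c else 0)) + \<alpha> * (pmf F c * (if c \<le> cost F s then 0 else sqrt c))"
    if c: "c \<in> set_pmf F" for c
  proof -
    have "0 < c"
      using c pos by auto
    then have "pmf F c * c * (\<alpha> / sqrt c) = \<alpha> * (pmf F c * sqrt c)"
      by (simp add: field_simps)
    then show ?thesis
      by simp
  qed
  then show ?thesis
    by (simp add: head_cost_eq[OF fin] tail_sqrt_cost_eq[OF fin] sum.distrib sum_distrib_left)
qed

lemma threshold_rule_cost: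
  assumes fin: "finite (set_pmf F)" and pos: "set_pmf F \<subseteq> {0<..}"
    and "s \<le> card (set_pmf F)" "t \<le> card (set_pmf F)"
  shows "threshold_rule F a s \<alpha> t = (if cost F t \<le> cost F s then a else \<alpha> / sqrt (cost F t))"
  by (simp add: threshold_rule_def cost_le_iff assms)

lemma threshold_spend_eq:
  assumes fin: "finite (set_pmf F)" and pos: "set_pmf F \<subseteq> {0<..}" and s: "s \<le> card (set_pmf F)"
  shows "threshold_spend F a s \<alpha> = a * head_cost F s + \<alpha> * tail_sqrt_cost F s"
proof -
  have "threshold_spend F a s \<alpha>
      = (\<Sum>t = 1..card (set_pmf F). (\<lambda>c. pmf F c * c * (if c \<le> cost F s then a else \<alpha> / sqrt c)) (cost F t))"
    by (simp add: threshold_spend_def threshold_rule_cost[OF fin pos s])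
  also have "\<dots> = (\<Sum>c\<in>set_pmf F. pmf F c * c * (if c \<le> cost F s then a else \<alpha> / sqrt c))"
    by (rule sum.reindex_bij_betw[OF bij_betw_cost[OF fin]])
  finally show ?thesis
    unfolding cost_rule_spend[OF fin pos] .
qed


subsection \<open>Cutoff costs\<close>

text \<open>
  For a cutoff cost \<open>k\<close>, the worst-case conditional mean of \<open>m\<close> at cost \<open>c\<close> is \<open>min 1 (c / k)\<close>
  and the optimal allocation is proportional to \<open>min 1 (sqrt (k / c))\<close>; \<open>mass F k\<close> is the
  resulting value of \<open>\<theta>\<close>, and \<open>spend F k\<close> the budget that is used up.
\<close>

definition mass :: "real pmf \<Rightarrow> real \<Rightarrow> real" where
  "mass F k = (\<Sum>c\<in>set_pmf F. pmf F c * min 1 (c / k))"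

definition spend :: "real pmf \<Rightarrow> real \<Rightarrow> real" where
  "spend F k = (\<Sum>c\<in>set_pmf F. pmf F c * min c (sqrt (k * c))) / max 1 (2 * mass F k)"

context
  fixes F :: "real pmf"
  assumes fin: "finite (set_pmf F)" and pos: "set_pmf F \<subseteq> {0<..}"
begin

lemma mass_antimono: "mass F l \<le> mass F k" if "0 < k" "k \<le> l"
  unfolding mass_def
proof (intro sum_mono mult_left_mono min.mono order_refl)
  fix c assume "c \<in> set_pmf F"
  then show "c / l \<le> c / k"
    using pos that by (intro divide_left_mono) auto
qed simp

text \<open>The numerator is nondecreasing in \<open>k\<close> and, by \<open>mass_antimono\<close>,
  the denominator is nonincreasing.\<close>

lemma spend_mono: "spend F k \<le> spend F l" if "0 < k" "k \<le> l"
  unfolding spend_def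
proof (rule frac_le)
  show "(\<Sum>c\<in>set_pmf F. pmf F c * min c (sqrt (k * c))) \<le> (\<Sum>c\<in>set_pmf F. pmf F c * min c (sqrt (l * c)))"
    using pos that by (intro sum_mono mult_left_mono min.mono) (auto intro!: mult_right_mono)
  show "0 \<le> (\<Sum>c\<in>set_pmf F. pmf F c * min c (sqrt (l * c)))"
    using pos that by (intro sum_nonneg mult_nonneg_nonneg) (auto simp: less_imp_le)
  show "max 1 (2 * mass F l) \<le> max 1 (2 * mass F k)"
    using mass_antimono[OF that] by simp
qed simp

lemma continuous_on_spend: "continuous_on {0<..} (spend F)"
  unfolding spend_def mass_def by (intro continuous_intros) auto

text \<open>A cutoff between neighbouring costs resolves every minimum by position alone, as
  \<open>c \<le> sqrt (k * c)\<close> amounts to \<open>c \<le> k\<close>. The inequalities are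
  weak, so \<open>k = cost F t\<close> is allowed, the case evaluated by the search.\<close>

lemma
  assumes k: "0 < k"
    and below: "\<And>c. c \<in> set_pmf F \<Longrightarrow> c \<le> cost F t \<Longrightarrow> c \<le> k"
    and above: "\<And>c. c \<in> set_pmf F \<Longrightarrow> cost F t < c \<Longrightarrow> k \<le> c"
  shows mass_eq: "mass F k = head_cost F t / k + tail_prob F t"
    and spend_eq: "spend F k = (head_cost F t + sqrt k * tail_sqrt_cost F t)
                      / max 1 (2 * (head_cost F t / k + tail_prob F t))"
proof -
  show mass: "mass F k = head_cost F t / k + tail_prob F t"
    unfolding mass_def head_cost_eq[OF fin] tail_prob_eq[OF fin] sum_divide_distrib sum.distrib[symmetric]
  proof (intro sum.cong refl)
    fix c assume c: "c \<in> set_pmf F"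
    have "min 1 (c / k) = (if c \<le> cost F t then c / k else 1)"
      using below[OF c] above[OF c] k by (auto simp: min_absorb1 min_absorb2 divide_le_eq_1 le_divide_eq_1)
    then show "pmf F c * min 1 (c / k)
        = pmf F c * (if c \<le> cost F t then c else 0) / k + pmf F c * (if c \<le> cost F t then 0 else 1)"
      by simp
  qed
  have "(\<Sum>c\<in>set_pmf F. pmf F c * min c (sqrt (k * c))) = head_cost F t + sqrt k * tail_sqrt_cost F t"
    unfolding head_cost_eq[OF fin] tail_sqrt_cost_eq[OF fin] sum_distrib_left sum.distrib[symmetric]
  proof (intro sum.cong refl)
    fix c assume c: "c \<in> set_pmf F"
    then have c0: "0 < c"
      using pos by auto
    have "min c (sqrt (k * c)) = (if c \<le> cost F t then c else sqrt k * sqrt c)"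
    proof (cases "c \<le> cost F t")
      case True
      then have "c * c \<le> k * c"
        using below[OF c] c0 by simp
      then have "c \<le> sqrt (k * c)"
        using c0 by (intro real_le_rsqrt) (simp add: power2_eq_square)
      with True show ?thesis
        by simp
    next
      case False
      then have "k * c \<le> c * c"
        using above[OF c] c0 by simp
      then have "sqrt (k * c) \<le> c"
        using c0 by (intro real_le_lsqrt) (auto simp: power2_eq_square)
      with False show ?thesis
        by (simp add: real_sqrt_mult)
    qed
    then show "pmf F c * min c (sqrt (k * c)) = pmf F c * (if c \<le> cost F t then c else 0)
        + sqrt k * (pmf F c * (if c \<le> cost F t then 0 else sqrt c))"
      by simp
  qed
  then show "spend F k = (head_cost F t + sqrt k * tail_sqrt_cost F t)
      / max 1 (2 * (head_cost F t / k + tail_prob F t))"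
    by (simp add: spend_def mass)
qed

section \<open>Existence of a cutoff that exhausts the budget\<close>

lemma ex_cutoff_between:
  assumes "0 < x" "0 < y" "spend F x \<le> Bbar" "Bbar < spend F y"
  obtains k where "x \<le> k" "k \<le> y" "spend F k = Bbar"
proof -
  have "x \<le> y"
    using spend_mono[of y x] assms by (cases "x \<le> y") auto
  moreover have "continuous_on {x..y} (spend F)"
    using assms by (intro continuous_on_subset[OF continuous_on_spend]) auto
  ultimately show ?thesis
    using IVT'[of "spend F" x Bbar y] assms that by auto
qed

lemma ex_cutoff_low:
  assumes "0 < Bbar"
  obtains x where "0 < x" "spend F x \<le> Bbar"
proof -
  define M where "M = (\<Sum>c\<in>set_pmf F. pmf F c * sqrt c)"
  have "0 < M"
    unfolding M_def using fin pos set_pmf_not_empty[of F]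
    by (intro sum_pos) (auto simp: pmf_positive)
  \<comment> \<open>Dropping the denominator and the minimum bounds \<open>spend F x\<close> by
    \<open>sqrt x * M\<close>, which this choice makes equal to \<open>Bbar\<close>.\<close>
  define x where "x = (Bbar / M)\<^sup>2"
  have x: "0 < x"
    using assms \<open>0 < M\<close> by (simp add: x_def)
  have "0 \<le> (\<Sum>c\<in>set_pmf F. pmf F c * min c (sqrt (x * c)))"
    using pos x by (intro sum_nonneg mult_nonneg_nonneg) (auto simp: less_imp_le)
  then have "spend F x \<le> (\<Sum>c\<in>set_pmf F. pmf F c * min c (sqrt (x * c))) / 1"
    unfolding spend_def by (intro divide_left_mono) auto
  also have "\<dots> \<le> (\<Sum>c\<in>set_pmf F. sqrt x * (pmf F c * sqrt c))"
    unfolding div_by_1 using x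
    by (intro sum_mono) (auto simp: real_sqrt_mult mult.left_commute[of "sqrt x"] intro!: mult_left_mono)
  also have "\<dots> = sqrt x * M"
    by (simp add: M_def sum_distrib_left)
  also have "\<dots> = Bbar"
    using assms \<open>0 < M\<close> by (simp add: x_def)
  finally show ?thesis
    using x that by blast
qed

lemma ex_cutoff_high:
  assumes "Bbar < measure_pmf.expectation F (\<lambda>c. c)"
  obtains y where "0 < y" "Bbar < spend F y"
proof -
  define E where "E = (\<Sum>c\<in>set_pmf F. pmf F c * c)"
  have E: "Bbar < E"
    using assms by (simp add: E_def expectation_eq_sum[OF fin])
  have E0: "0 < E"
    unfolding E_def using fin pos set_pmf_not_empty[of F] by (intro sum_pos) (auto simp: pmf_positive)
  \<comment> \<open>A cutoff above every cost turns each minimum in the numerator into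
    \<open>c\<close>; \<open>2 * E \<le> y\<close> gives \<open>mass F y \<le> 1 / 2\<close>, so the
    denominator is 1.\<close>
  define y where "y = max (Max (set_pmf F)) (2 * E)"
  have y: "0 < y"
    using E0 by (simp add: y_def less_max_iff_disj)
  have cy: "c \<le> y" if "c \<in> set_pmf F" for c
    using that fin by (simp add: y_def le_max_iff_disj)
  have "mass F y = (\<Sum>c\<in>set_pmf F. pmf F c * c) / y"
    unfolding mass_def sum_divide_distrib using cy y
    by (intro sum.cong refl) (simp add: min_absorb2)
  then have "mass F y * y = E"
    using y by (simp add: E_def)
  moreover have "2 * E \<le> y"
    by (simp add: y_def)
  ultimately have "2 * mass F y * y \<le> 1 * y"
    by simp
  then have m: "2 * mass F y \<le> 1"
    using y by (simp only: mult_le_cancel_right_pos)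
  have "min c (sqrt (y * c)) = c" if c: "c \<in> set_pmf F" for c
  proof -
    have "c * c \<le> y * c"
      using cy[OF c] pos c by (intro mult_right_mono) auto
    then have "c \<le> sqrt (y * c)"
      by (intro real_le_rsqrt) (simp add: power2_eq_square)
    then show ?thesis
      by simp
  qed
  then have "spend F y = E"
    using m by (simp add: spend_def E_def)
  then show ?thesis
    using that y E by simp
qed

end

text \<open>
  Eliminating \<open>k\<close> from the equations \<open>a * (H + sqrt k * R) = Bbar\<close> and \<open>2 * a * (H / k + P) = 1\<close>
  gives the cubic equation. If instead \<open>a = 1\<close> and the second left-hand side is less than \<open>1\<close>, then
  the root exceeds \<open>1\<close>; if \<open>R = P = 0\<close>, then the cubic is \<open>- (Bbar - H * a)\<^sup>2\<close>.
\<close>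

lemma cubic_root_eq:
  fixes H P R Bbar k :: real
  defines "a \<equiv> 1 / max 1 (2 * (H / k + P))"
  defines "f \<equiv> \<lambda>x. 2 * H * R\<^sup>2 * x ^ 3 + (2 * P * x - 1) * (Bbar - x * H)\<^sup>2"
  assumes k: "0 < k" and H: "0 \<le> H" and Bbar: "0 < Bbar"
    and budget: "a * (H + sqrt k * R) = Bbar"
    and cases: "0 < R \<and> 0 < P \<or> R = 0 \<and> P = 0 \<and> Bbar < H"
  shows "min 1 (Inf {x. 0 < x \<and> f x = 0}) = a"
  using cases
proof
  assume R: "R = 0 \<and> P = 0 \<and> Bbar < H"
  have "a * H = Bbar"
    using budget R by simp
  then have "f x = 0 \<longleftrightarrow> a * H = x * H" for x
    using R by (simp add: f_def)
  moreover have "0 < a" "H \<noteq> 0"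
    using R Bbar by (auto simp: a_def)
  ultimately have "{x. 0 < x \<and> f x = 0} = {a}"
    by auto
  moreover have "a \<le> 1"
    by (simp add: a_def)
  ultimately show ?thesis
    by simp
next
  assume R: "0 < R \<and> 0 < P"
  \<comment> \<open>With \<open>\<alpha>\<close> the budget equation reads
    \<open>Bbar - a * H = \<alpha> * R\<close>, and multiplying by
    \<open>\<alpha>\<^sup>2 = a\<^sup>2 * k\<close> clears the denominator \<open>k\<close> from the
    other condition.\<close>
  define \<alpha> where "\<alpha> = a * sqrt k"
  have a: "0 < a" "a \<le> 1"
    by (simp_all add: a_def)
  have \<alpha>: "0 < \<alpha>"
    using a k by (simp add: \<alpha>_def)
  have Ba: "Bbar - a * H = \<alpha> * R"
    using budget by (simp add: \<alpha>_def algebra_simps)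
  have "a * max 1 (2 * (H / k + P)) = 1"
    by (simp add: a_def)
  moreover have "a * (2 * (H / k + P)) \<le> a * max 1 (2 * (H / k + P))"
    using a by (intro mult_left_mono) auto
  ultimately have "2 * a * (H / k + P) \<le> 1"
    by (simp add: algebra_simps)
  then have "2 * a * (H / k + P) * \<alpha>\<^sup>2 \<le> 1 * \<alpha>\<^sup>2"
    by (intro mult_right_mono) auto
  moreover have \<alpha>2: "\<alpha>\<^sup>2 = a\<^sup>2 * k"
    using k by (simp add: \<alpha>_def power_mult_distrib)
  moreover have expand: "2 * a * (H / k + P) * \<alpha>\<^sup>2 = 2 * H * a ^ 3 + 2 * P * a * \<alpha>\<^sup>2"
    using k unfolding \<alpha>2 by (simp add: field_simps power2_eq_square power3_eq_cube)
  ultimately have le: "2 * H * a ^ 3 + 2 * P * a * \<alpha>\<^sup>2 \<le> \<alpha>\<^sup>2"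
    by simp
  have fa: "f a = R\<^sup>2 * (2 * H * a ^ 3 + 2 * P * a * \<alpha>\<^sup>2 - \<alpha>\<^sup>2)"
    unfolding f_def Ba by (simp add: algebra_simps power_mult_distrib)
  \<comment> \<open>For \<open>x < a\<close> the factor \<open>2 * P * x - 1\<close> is negative and
    \<open>\<alpha> * R \<le> Bbar - x * H\<close>, so \<open>f x\<close> is at most an expression
    that increases in \<open>x\<close> and is at most 0 at \<open>a\<close>. No positive root lies
    below \<open>a\<close>.\<close>
  have neg: "f x < 0" if x: "0 < x" "x < a" for x
  proof -
    have "\<alpha> * R \<le> Bbar - x * H"
      using Ba x H mult_right_mono[of x a H] by simp
    moreover have "0 < \<alpha> * R"
      using \<alpha> R by simp
    ultimately have s: "(\<alpha> * R)\<^sup>2 \<le> (Bbar - x * H)\<^sup>2"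
      by (intro power_mono) auto
    have "2 * P * x * \<alpha>\<^sup>2 < 2 * P * a * \<alpha>\<^sup>2"
      using R x \<alpha> by simp
    also have "2 * P * a * \<alpha>\<^sup>2 \<le> \<alpha>\<^sup>2"
      using le H a by (smt (verit) mult_nonneg_nonneg zero_le_power)
    finally have "2 * P * x < 1"
      using \<alpha> by (simp add: mult_less_cancel_right)
    then have "f x \<le> 2 * H * R\<^sup>2 * x ^ 3 + (2 * P * x - 1) * (\<alpha> * R)\<^sup>2"
      unfolding f_def using mult_left_mono_neg[OF s, of "2 * P * x - 1"] by simp
    also have "\<dots> = R\<^sup>2 * (2 * H * x ^ 3 + 2 * P * x * \<alpha>\<^sup>2 - \<alpha>\<^sup>2)"
      by (simp add: algebra_simps power_mult_distrib)
    also have "\<dots> < 0"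
    proof -
      have "2 * H * x ^ 3 \<le> 2 * H * a ^ 3"
        using H x by (intro mult_left_mono power_mono) auto
      then have "2 * H * x ^ 3 + 2 * P * x * \<alpha>\<^sup>2 - \<alpha>\<^sup>2 < 0"
        using \<open>2 * P * x * \<alpha>\<^sup>2 < 2 * P * a * \<alpha>\<^sup>2\<close> le by linarith
      then show ?thesis
        using R by (simp add: mult_less_0_iff)
    qed
    finally show ?thesis .
  qed
  have ge: "a \<le> x" if "x \<in> {x. 0 < x \<and> f x = 0}" for x
    using neg[of x] that by force
  show ?thesis
  proof (cases "1 \<le> 2 * (H / k + P)")
    case True
    then have "2 * a * (H / k + P) = 1"
      by (simp add: a_def max_def)
    then have "2 * a * (H / k + P) * \<alpha>\<^sup>2 = \<alpha>\<^sup>2"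
      by simp
    then have "f a = 0"
      unfolding fa expand by simp
    then have "Inf {x. 0 < x \<and> f x = 0} = a"
      using a ge by (intro cInf_eq_minimum) auto
    then show ?thesis
      using a by simp
  next
    case False
    then have a1: "a = 1"
      by (simp add: a_def)
    have "2 * P \<le> 2 * (H / k + P)"
      using H k by simp
    then have "2 * P < 1"
      using False by linarith
    \<comment> \<open>At \<open>1 / (2 * P)\<close> the second summand of \<open>f\<close> vanishes,
      which makes \<open>f\<close> nonnegative there. A root must exist, as the infimum of the empty
      set is unspecified; its value is irrelevant after truncation at 1.\<close>
    then have y: "1 \<le> 1 / (2 * P)"
      using R by simp
    have "f 1 \<le> 0"
      using fa le R by (simp add: a1 mult_le_0_iff)
    moreover have "0 \<le> f (1 / (2 * P))"
      using R H by (simp add: f_def)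
    moreover have "continuous_on {1..1 / (2 * P)} f"
      unfolding f_def by (intro continuous_intros)
    ultimately obtain x where "1 \<le> x" "f x = 0"
      using IVT'[of f 1 0 "1 / (2 * P)"] y by auto
    then have "x \<in> {x. 0 < x \<and> f x = 0}"
      by simp
    then have "1 \<le> Inf {x. 0 < x \<and> f x = 0}"
      using ge a1 by (intro cInf_greatest) blast+
    then show ?thesis
      using a1 by simp
  qed
qed


subsection \<open>Binary search for the threshold\<close>

text \<open>\<open>expr\<close> has no maximum or absolute value; the square root of the square
  supplies \<open>\<bar>a - b\<bar>\<close>.\<close>

definition max_expr :: "expr \<Rightarrow> expr \<Rightarrow> expr" where
  "max_expr a b = Div (Add (Add a b) (Sqrt (Mul (Sub a b) (Sub a b)))) (Const 2)"

definition min_expr :: "expr \<Rightarrow> expr \<Rightarrow> expr" where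
  "min_expr a b = Div (Sub (Add a b) (Sqrt (Mul (Sub a b) (Sub a b)))) (Const 2)"

lemma expr_val_max_min:
  "expr_val F Bbar (max_expr a b) = max (expr_val F Bbar a) (expr_val F Bbar b)"
  "expr_val F Bbar (min_expr a b) = min (expr_val F Bbar a) (expr_val F Bbar b)"
  by (auto simp: max_expr_def min_expr_def max_def min_def)

text \<open>This is \<open>spend F (cost F t)\<close> in terms of table entries. The search compares
  it only at positions from 1 on, so the divisor \<open>Cost t\<close> is never the sentinel
  0.\<close>

definition spend_expr :: "nat \<Rightarrow> expr" where
  "spend_expr t =
     Div (Add (Head_Cost t) (Mul (Sqrt (Cost t)) (Tail_Sqrt_Cost t)))
       (max_expr (Const 1) (Mul (Const 2) (Add (Div (Head_Cost t) (Cost t)) (Tail_Prob t))))"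

text \<open>The coefficients are those of \<open>2 * H * R\<^sup>2 * x ^ 3 + (2 * P * x - 1) * (B -
  x * H)\<^sup>2\<close> multiplied out. Constants are natural numbers, so negation is subtraction
  from 0.\<close>

definition level_expr :: "nat \<Rightarrow> expr" where
  "level_expr t =
    (let H = Head_Cost t; P = Tail_Prob t; R = Tail_Sqrt_Cost t; B = Budget; two = Const 2 in
     min_expr (Const 1)
       (Cubic_Root
          (Add (Mul two (Mul H (Mul R R))) (Mul two (Mul P (Mul H H))))
          (Sub (Const 0) (Add (Mul (Const 4) (Mul P (Mul B H))) (Mul H H)))
          (Add (Mul two (Mul P (Mul B B))) (Mul two (Mul B H)))
          (Sub (Const 0) (Mul B B))))"

lemma level_expr_val:
  "expr_val F Bbar (level_expr t) =
     min 1 (Inf {x. 0 < x \<and> 2 * head_cost F t * (tail_sqrt_cost F t)\<^sup>2 * x ^ 3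
              + (2 * tail_prob F t * x - 1) * (Bbar - x * head_cost F t)\<^sup>2 = 0})"
  by (simp add: level_expr_def Let_def expr_val_max_min power2_diff)
    (simp add: algebra_simps power2_eq_square power3_eq_cube)

text \<open>The threshold lies among the \<open>2 ^ d\<close> positions from \<open>s\<close> on,
  and each level probes the midpoint. Positions beyond \<open>N\<close> count as too expensive
  without a comparison.\<close>

primrec search_from :: "nat \<Rightarrow> nat \<Rightarrow> nat \<Rightarrow> search" where
  "search_from N 0 s = Output (level_expr s) s"
| "search_from N (Suc d) s =
     (if s + 2 ^ d \<le> N
      then If_Le (spend_expr (s + 2 ^ d)) Budget (search_from N d (s + 2 ^ d)) (search_from N d s)
      else search_from N d s)"

text \<open>Invariant: the cutoff at \<open>s\<close> is affordable (or \<open>s = 0\<close>), and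
  the one at \<open>s + 2 ^ d\<close> is too expensive or beyond the table. At \<open>d = 0\<close>
  the two positions are neighbours.\<close>

lemma search_from_output:
  assumes "s \<le> N"
    and "s = 0 \<or> expr_val F Bbar (spend_expr s) \<le> Bbar"
    and "N < s + 2 ^ d \<or> Bbar < expr_val F Bbar (spend_expr (s + 2 ^ d))"
  obtains t where "t \<le> N" "search_output F Bbar (search_from N d s) = (expr_val F Bbar (level_expr t), t)"
    and "t = 0 \<or> expr_val F Bbar (spend_expr t) \<le> Bbar"
    and "t = N \<or> Bbar < expr_val F Bbar (spend_expr (Suc t))"
  using assms
proof (induction d arbitrary: s thesis)
  case 0
  then show ?case
    by (intro "0.prems"(1)[of s]) auto
next
  case (Suc d)
  consider "s + 2 ^ d \<le> N" "expr_val F Bbar (spend_expr (s + 2 ^ d)) \<le> Bbar"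
    | "s + 2 ^ d \<le> N" "Bbar < expr_val F Bbar (spend_expr (s + 2 ^ d))"
    | "N < s + 2 ^ d"
    by linarith
  then show ?case
  proof cases
    case 1
    show ?thesis
      by (rule Suc.IH[of "s + 2 ^ d"])
        (use 1 Suc.prems in \<open>auto simp: add.assoc simp flip: mult_2 intro: Suc.prems(1)\<close>)
  next
    case 2
    show ?thesis
      by (rule Suc.IH[of s]) (use 2 Suc.prems in \<open>auto intro: Suc.prems(1)\<close>)
  next
    case 3
    show ?thesis
      by (rule Suc.IH[of s]) (use 3 Suc.prems in \<open>auto intro: Suc.prems(1)\<close>)
  qed
qed

text \<open>Step counts of the expressions do not depend on the position, so those at 0 stand for
  all. A level adds at most one probe, the access to \<open>Budget\<close> and the comparison, hence
  the \<open>+ 2\<close>.\<close>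

lemma search_from_steps:
  "search_steps F Bbar (search_from N d s) \<le> (expr_steps (spend_expr 0) + 2) * d + (expr_steps (level_expr 0) + 1)"
proof (induction d arbitrary: s)
  case 0
  then show ?case
    by (simp add: level_expr_def min_expr_def Let_def)
next
  case (Suc d)
  define K where "K = expr_steps (spend_expr 0)"
  have "expr_steps (spend_expr t) = K" for t
    by (simp add: K_def spend_expr_def max_expr_def)
  then show ?case
    using Suc.IH[of s] Suc.IH[of "s + 2 ^ d"] by (auto simp: algebra_simps)
qed

section \<open>Logarithmic depth of the search\<close>

definition search_depth :: "nat \<Rightarrow> nat" where
  "search_depth N = nat \<lceil>log 2 (real N + 1)\<rceil>"

lemma less_two_power_search_depth: "N < 2 ^ search_depth N"
proof -
  have "log 2 (real N + 1) \<le> real (search_depth N)"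
    unfolding search_depth_def by (rule real_nat_ceiling_ge)
  then have "real N + 1 \<le> 2 ^ search_depth N"
    by (simp add: log_le_iff powr_realpow)
  then have "real (N + 1) \<le> real (2 ^ search_depth N)"
    by simp
  then show ?thesis
    by (simp only: of_nat_le_iff)
qed

text \<open>For \<open>N \<ge> 2\<close>, \<open>N + 1 \<le> N * N\<close> and
  \<open>1 \<le> log 2 N\<close>, so the depth is at most \<open>3 * log 2 N\<close> and the offset
  \<open>b\<close> is absorbed.\<close>

lemma search_depth_bigo: "(\<lambda>N. real (a * search_depth N + b)) \<in> O(\<lambda>N. ln (real N))"
proof (rule landau_o.bigI)
  let ?c = "(3 * real a + real b + 1) / ln 2"
  show "0 < ?c"
    by simp
  show "\<forall>\<^sub>F N in at_top. norm (real (a * search_depth N + b)) \<le> ?c * norm (ln (real N))"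
    using eventually_ge_at_top[of 2]
  proof eventually_elim
    case (elim N)
    have "N + 1 \<le> N * N"
      using elim mult_le_mono1[of 2 N N] by linarith
    then have "real N + 1 \<le> real N * real N"
      by (metis of_nat_1 of_nat_add of_nat_le_iff of_nat_mult)
    then have "log 2 (real N + 1) \<le> log 2 (real N * real N)"
      using elim by (subst log_le_cancel_iff) auto
    also have "\<dots> = 2 * log 2 (real N)"
      using elim by (simp add: log_mult)
    finally have log: "log 2 (real N + 1) \<le> 2 * log 2 (real N)" .
    have one: "1 \<le> log 2 (real N)"
      using elim by (simp add: le_log_iff)
    have "real (search_depth N) \<le> log 2 (real N + 1) + 1"
      using ceiling_correct[of "log 2 (real N + 1)"] one log
      by (simp add: search_depth_def le_nat_iff)
    then have "real (search_depth N) \<le> 3 * log 2 (real N)"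
      using log one by linarith
    then have "real a * real (search_depth N) + real b * 1 \<le> real a * (3 * log 2 (real N)) + (real b + 1) * log 2 (real N)"
      using one by (intro add_mono mult_left_mono mult_mono) auto
    also have "\<dots> = ?c * ln (real N)"
      by (simp add: log_def field_simps)
    finally show ?case
      using elim by simp
  qed
qed


subsection \<open>The optimal allocation\<close>

text \<open>The rule and \<open>q\<close> form a saddle point: up to the threshold nature is
  indifferent because \<open>1 / A0 c = 2 * T\<close>, and beyond it \<open>q c = 1\<close> is
  extreme.\<close>

lemma cutoff_rule_optimal:
  assumes fin: "finite (set_pmf F)" and pos: "set_pmf F \<subseteq> {0<..}"
    and m: "moment_function Z m" and n: "0 < n"
    and k: "0 < k"
    and below: "\<And>c. c \<in> set_pmf F \<Longrightarrow> c \<le> cost F t \<Longrightarrow> c \<le> k"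
    and above: "\<And>c. c \<in> set_pmf F \<Longrightarrow> cost F t < c \<Longrightarrow> k \<le> c"
    and spend: "spend F k = Bbar"
  defines "a \<equiv> 1 / max 1 (2 * mass F k)"
  shows "optimal_allocation Z m n F Bbar A \<longleftrightarrow>
           (\<forall>c\<in>set_pmf F. A c = (if c \<le> cost F t then a else a * sqrt k / sqrt c))"
proof -
  let ?C = "set_pmf F"
  define A0 where "A0 c = (if c \<le> cost F t then a else a * sqrt k / sqrt c)" for c
  define M where "M = mass F k"
  define T where "T = 1 / (2 * a)"
  \<comment> \<open>\<open>s\<close> solves \<open>(1 - s) * M + s = 1 / 2\<close>. If
    \<open>M < 1 / 2\<close>, the level is capped at 1 and \<open>T = 1 / 2\<close>; mixing
    \<open>u\<close> with the constant 1 lifts its mean from \<open>M\<close> to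
    \<open>T\<close>.\<close>
  define s where "s = (if 1 \<le> 2 * M then 0 else (1 / 2 - M) / (1 - M))"
  define u where "u c = min 1 (c / k)" for c
  define q where "q c = (1 - s) * u c + s" for c
  have c0: "0 < c" if "c \<in> ?C" for c
    using that pos by auto
  have a: "0 < a" "a \<le> 1"
    by (simp_all add: a_def)
  have M: "0 \<le> M"
    unfolding M_def mass_def using k pos
    by (intro sum_nonneg mult_nonneg_nonneg) (auto simp: less_imp_le)
  have s01: "0 \<le> s" "s \<le> 1"
    using M by (auto simp: s_def divide_simps)
  \<comment> \<open>A nonzero shift occurs only together with \<open>a = 1\<close>, where the
    analyst's condition is a mere inequality.\<close>
  have as: "a = 1 \<or> s = 0"
    by (auto simp: a_def s_def M_def)
  have T2: "2 * T = 1 / a"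
    by (simp add: T_def)
  have u01: "0 < u c" "u c \<le> 1" if "c \<in> ?C" for c
    using c0[OF that] k by (auto simp: u_def)
  have q_eq: "q c = u c + s * (1 - u c)" for c
    by (simp add: q_def algebra_simps)
  have u_le_q: "u c \<le> q c" if "c \<in> ?C" for c
    using u01[OF that] s01 by (simp add: q_eq)
  have q01: "0 < q c \<and> q c \<le> 1" if "c \<in> ?C" for c
  proof -
    have "s * (1 - u c) \<le> 1 * (1 - u c)"
      using u01[OF that] s01 by (intro mult_right_mono) auto
    then show ?thesis
      using u01[OF that] u_le_q[OF that] by (simp add: q_eq)
  qed
  have tail: "u c = 1" "q c = 1" "A0 c = a * sqrt k / sqrt c" "A0 c \<le> a" "0 < A0 c"
    if c: "c \<in> ?C" "\<not> c \<le> cost F t" for c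
  proof -
    have kc: "k \<le> c"
      using above c by auto
    then show "u c = 1"
      using k by (simp add: u_def)
    then show "q c = 1"
      by (simp add: q_def)
    show A0: "A0 c = a * sqrt k / sqrt c"
      using c by (simp add: A0_def)
    show "A0 c \<le> a"
      unfolding A0 using a c0[OF c(1)] kc by (simp add: divide_le_eq)
    show "0 < A0 c"
      unfolding A0 using a c0[OF c(1)] k by simp
  qed
  have A0_pos: "0 < A0 c" and A0_le: "A0 c \<le> a" if "c \<in> ?C" for c
    using tail[of c] that a by (cases "c \<le> cost F t"; simp add: A0_def)+
  have budget: "(\<Sum>c\<in>?C. pmf F c * c * A0 c) = Bbar"
  proof -
    have "(\<Sum>c\<in>?C. pmf F c * c * A0 c) = a * head_cost F t + a * sqrt k * tail_sqrt_cost F t"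
      unfolding A0_def by (rule cost_rule_spend[OF fin pos])
    also have "\<dots> = spend F k"
      using spend_eq[OF fin pos k below above] mass_eq[OF fin pos k below above]
      by (simp add: a_def add_divide_distrib)
    finally show ?thesis
      using spend by simp
  qed
  have "optimal_allocation Z m n F Bbar A \<longleftrightarrow> (\<forall>c\<in>?C. A c = A0 c)"
  \<comment> \<open>The multiplier comes from stationarity: \<open>c / (a\<^sup>2 * k)\<close> is
    \<open>q c / (A0 c)\<^sup>2\<close> on the tail and \<open>u c / a\<^sup>2\<close> on the
    head.\<close>
  proof (rule saddle_point_optimal[OF fin m n, where q = q and T = T and \<mu> = "1 / (a\<^sup>2 * k)"])
    have "antimono_on ?C A0"
    proof (rule monotone_onI)
      fix c d assume c: "c \<in> ?C" and d: "d \<in> ?C" and cd: "c \<le> d"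
      show "A0 d \<le> A0 c"
      proof (cases "c \<le> cost F t")
        case True
        then show ?thesis
          using A0_le[OF d] by (simp add: A0_def)
      next
        case False
        then show ?thesis
          using cd a k c0[OF c] by (auto simp: A0_def intro!: divide_left_mono)
      qed
    qed
    then show "feasible F Bbar A0"
      using A0_pos A0_le a budget by (auto simp: feasible_def intro: order_trans)
    have "(\<Sum>c\<in>?C. pmf F c * q c) = (1 - s) * (\<Sum>c\<in>?C. pmf F c * u c) + s * (\<Sum>c\<in>?C. pmf F c)"
      by (simp add: q_def sum_distrib_left distrib_left sum.distrib mult_ac)
    also have "\<dots> = (1 - s) * M + s"
      using sum_pmf_eq_1[OF fin order_refl] by (simp add: M_def mass_def u_def)
    also have "\<dots> = T"
    proof (cases "1 \<le> 2 * M")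
      case True
      then show ?thesis
        by (simp add: T_def s_def a_def M_def max_def)
    next
      case False
      then have "s * (1 - M) = 1 / 2 - M"
        by (simp add: s_def)
      then show ?thesis
        using False by (simp add: T_def a_def M_def algebra_simps)
    qed
    finally show "(\<Sum>c\<in>?C. pmf F c * q c) = T" .
    show "0 \<le> 1 / (a\<^sup>2 * k)"
      using k by simp
    fix c assume c: "c \<in> ?C"
    show "0 < q c \<and> q c \<le> 1"
      by (rule q01[OF c])
    show "2 * T \<le> 1 / A0 c \<and> (q c = 1 \<or> 2 * T = 1 / A0 c)"
    proof (cases "c \<le> cost F t")
      case True
      then show ?thesis
        by (simp add: A0_def T2)
    next
      case False
      then show ?thesis
        using tail(2)[OF c False] divide_left_mono[OF A0_le[OF c], of 1] A0_pos[OF c] a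
        by (simp add: T2)
    qed
    show "1 / (a\<^sup>2 * k) * c \<le> q c / (A0 c)\<^sup>2 \<and> (A0 c = 1 \<or> 1 / (a\<^sup>2 * k) * c = q c / (A0 c)\<^sup>2)"
    proof (cases "c \<le> cost F t")
      case True
      then have u: "u c = c / k"
        using below[OF c] k by (simp add: u_def min_absorb2)
      have A0: "A0 c = a"
        using True by (simp add: A0_def)
      have eq: "1 / (a\<^sup>2 * k) * c = u c / a\<^sup>2"
        by (simp add: u)
      have "u c / a\<^sup>2 \<le> q c / a\<^sup>2"
        using u_le_q[OF c] by (simp add: divide_right_mono)
      moreover have "a = 1 \<or> u c / a\<^sup>2 = q c / a\<^sup>2"
        using as by (auto simp: q_eq)
      ultimately show ?thesis
        unfolding A0 eq by blast
    next
      case False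
      then have "1 / (a\<^sup>2 * k) * c = q c / (A0 c)\<^sup>2"
        using tail[OF c] c0[OF c] k by (simp add: power_divide power_mult_distrib)
      then show ?thesis
        by simp
    qed
  qed (rule budget)
  then show ?thesis
    unfolding A0_def .
qed

lemma spend_expr_val:
  assumes fin: "finite (set_pmf F)" and pos: "set_pmf F \<subseteq> {0<..}"
    and t: "1 \<le> t" "t \<le> card (set_pmf F)"
  shows "expr_val F Bbar (spend_expr t) = spend F (cost F t)"
proof -
  have "0 < cost F t"
    using cost_in_support[OF fin t] pos by auto
  then show ?thesis
    by (subst spend_eq[OF fin pos, where t = t]) (auto simp: spend_expr_def expr_val_max_min)
qed

theorem theorem1:
  "\<exists>(search :: nat \<Rightarrow> search) (time :: nat \<Rightarrow> nat).
     (\<lambda>N. real (time N)) \<in> O(\<lambda>N. ln (real N)) \<and>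
     (\<forall>(Z :: 'z measure) (m :: 'z \<Rightarrow> real) (n :: nat) (F :: real pmf) (B :: real) (Bbar :: real).
        moment_function Z m \<and> 0 < n \<and>
        finite (set_pmf F) \<and> set_pmf F \<subseteq> {0<..} \<and>
        Bbar = B / real n \<and> 0 < Bbar \<and> Bbar < measure_pmf.expectation F (\<lambda>c. c) \<longrightarrow>
        (\<exists>Abar tstar \<alpha>.
           tstar \<le> card (set_pmf F) \<and>
           (\<forall>A. optimal_allocation Z m n F Bbar A \<longleftrightarrow>
                (\<forall>t\<in>{1..card (set_pmf F)}. A (cost F t) = threshold_rule F Abar tstar \<alpha> t)) \<and>
           threshold_spend F Abar tstar \<alpha> = Bbar \<and>
           (tstar < card (set_pmf F) \<longrightarrow>
              (\<forall>a. threshold_spend F Abar tstar a = Bbar \<longleftrightarrow> a = \<alpha>) \<and>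
              \<alpha> = (Bbar - Abar * head_cost F tstar) / tail_sqrt_cost F tstar) \<and>
           search_output F Bbar (search (card (set_pmf F))) = (Abar, tstar) \<and>
           search_steps F Bbar (search (card (set_pmf F))) \<le> time (card (set_pmf F))))"
proof -
  define search where "search N = search_from N (search_depth N) 0" for N
  define time where "time N = (expr_steps (spend_expr 0) + 2) * search_depth N + (expr_steps (level_expr 0) + 1)"
    for N
  show ?thesis
  proof (intro exI[of _ search] exI[of _ time] conjI allI impI)
    show "(\<lambda>N. real (time N)) \<in> O(\<lambda>N. ln (real N))"
      unfolding time_def by (rule search_depth_bigo)
  next
    fix Z :: "'z measure" and m :: "'z \<Rightarrow> real" and n :: nat and F :: "real pmf" and B Bbar :: real
    assume asm: "moment_function Z m \<and> 0 < n \<and>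
        finite (set_pmf F) \<and> set_pmf F \<subseteq> {0<..} \<and>
        Bbar = B / real n \<and> 0 < Bbar \<and> Bbar < measure_pmf.expectation F (\<lambda>c. c)"
    then have m: "moment_function Z m" and n: "0 < n"
      and fin: "finite (set_pmf F)" and pos: "set_pmf F \<subseteq> {0<..}"
      and Bbar: "0 < Bbar" "Bbar < measure_pmf.expectation F (\<lambda>c. c)"
      by auto
    let ?C = "set_pmf F"
    define N where "N = card ?C"
    have C: "?C = cost F ` {1..N}"
      using bij_betw_cost[OF fin] by (simp add: bij_betw_def N_def)
    obtain t where t: "t \<le> N"
      and found: "search_output F Bbar (search N) = (expr_val F Bbar (level_expr t), t)"
      and low: "t = 0 \<or> expr_val F Bbar (spend_expr t) \<le> Bbar"
      and high: "t = N \<or> Bbar < expr_val F Bbar (spend_expr (Suc t))"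
      unfolding search_def
      by (rule search_from_output[of 0 N F Bbar "search_depth N"])
        (use less_two_power_search_depth[of N] in auto)
    \<comment> \<open>The cutoff is bracketed by \<open>x\<close> and \<open>y\<close>, normally the
      neighbouring costs. At \<open>t = 0\<close> and \<open>t = N\<close> one of these is missing,
      and a sufficiently small or large cutoff replaces it.\<close>
    obtain x where x: "0 < x" "cost F t \<le> x" "spend F x \<le> Bbar"
    proof (cases "t = 0")
      case True
      then show ?thesis
        using ex_cutoff_low[OF fin pos Bbar(1)] that by (force simp: cost_def)
    next
      case False
      then have "0 < cost F t"
        using cost_in_support[OF fin, of t] t pos by (auto simp: N_def)
      then show ?thesis
        using low False t spend_expr_val[OF fin pos, of t] that[of "cost F t"] by (auto simp: N_def)
    qed
    obtain y where y: "0 < y" "t < N \<Longrightarrow> y = cost F (Suc t)" "Bbar < spend F y"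
    proof (cases "t = N")
      case True
      then show ?thesis
        using ex_cutoff_high[OF fin pos Bbar(2)] that by force
    next
      case False
      then have "0 < cost F (Suc t)"
        using cost_in_support[OF fin, of "Suc t"] t pos by (auto simp: N_def)
      then show ?thesis
        using high False t spend_expr_val[OF fin pos, of "Suc t"] that[of "cost F (Suc t)"]
        by (auto simp: N_def)
    qed
    obtain k where k: "x \<le> k" "k \<le> y" "spend F k = Bbar"
      by (rule ex_cutoff_between[OF fin pos x(1) y(1) x(3) y(3)])
    have k0: "0 < k"
      using x k by simp
    have below: "c \<le> k" if "c \<in> ?C" "c \<le> cost F t" for c
      using that x k by simp
    have above: "t < N \<and> k \<le> c" if c: "c \<in> ?C" "cost F t < c" for c
    proof -
      obtain s where s: "s \<le> N" "c = cost F s"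
        using c(1) C by auto
      then have "\<not> s \<le> t"
        using cost_le_iff[OF fin pos, of s t] c t by (simp add: N_def)
      then have "t < N" "cost F (Suc t) \<le> c"
        using s cost_le_iff[OF fin pos, of "Suc t" s] by (auto simp: N_def)
      then show ?thesis
        using y k by simp
    qed
    note cutoff = k0 below above[THEN conjunct2]
    let ?H = "head_cost F t" and ?P = "tail_prob F t" and ?R = "tail_sqrt_cost F t"
    define a where "a = 1 / max 1 (2 * (?H / k + ?P))"
    have mass: "mass F k = ?H / k + ?P"
      by (rule mass_eq[OF fin pos cutoff])
    have budget: "a * (?H + sqrt k * ?R) = Bbar"
      using spend_eq[OF fin pos cutoff] k(3) by (simp add: a_def)
    have H: "0 \<le> ?H"
      unfolding head_cost_eq[OF fin] using pos by (intro sum_nonneg) (auto simp: less_imp_le)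
    have RP: "0 < ?R \<and> 0 < ?P" if "t < N"
    proof -
      have c: "cost F (Suc t) \<in> ?C" "\<not> cost F (Suc t) \<le> cost F t"
        using cost_in_support[OF fin, of "Suc t"] cost_less[OF fin pos, of t "Suc t"] that
        by (auto simp: N_def)
      then have "0 < cost F (Suc t)"
        using pos by auto
      then show ?thesis
        unfolding tail_sqrt_cost_eq[OF fin] tail_prob_eq[OF fin] using c pos
        by (intro conjI sum_pos2[OF fin c(1)]) (auto simp: pmf_positive less_imp_le)
    qed
    \<comment> \<open>The two cases of \<open>cubic_root_eq\<close>: at \<open>t = N\<close> the
      rule is constant, the tail moments vanish, and \<open>?H\<close> is the full mean cost, which
      exceeds \<open>Bbar\<close>.\<close>
    have "0 < ?R \<and> 0 < ?P \<or> ?R = 0 \<and> ?P = 0 \<and> Bbar < ?H"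
    proof (cases "t < N")
      case False
      then have le: "c \<le> cost F t" if "c \<in> ?C" for c
        using above that by force
      have "?R = 0" "?P = 0"
        unfolding tail_sqrt_cost_eq[OF fin] tail_prob_eq[OF fin] using le by simp_all
      moreover have "?H = measure_pmf.expectation F (\<lambda>c. c)"
        unfolding head_cost_eq[OF fin] expectation_eq_sum[OF fin] using le by simp
      ultimately show ?thesis
        using Bbar by simp
    qed (use RP in blast)
    then have "expr_val F Bbar (level_expr t) = a"
      unfolding level_expr_val a_def
      using cubic_root_eq[OF k0 H Bbar(1) budget[unfolded a_def]] by simp
    with found have result: "search_output F Bbar (search N) = (a, t)"
      by simp
    \<comment> \<open>The tail meets the top level at the cutoff:
      \<open>\<alpha> / sqrt k = a\<close>.\<close>
    define \<alpha> where "\<alpha> = a * sqrt k"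
    have spend: "threshold_spend F a t b = a * ?H + b * ?R" for b
      using threshold_spend_eq[OF fin pos] t by (simp add: N_def)
    have binding: "a * ?H + \<alpha> * ?R = Bbar"
      using budget by (simp add: \<alpha>_def algebra_simps)
    then have \<alpha>_eq: "\<alpha> = (Bbar - a * ?H) / ?R" if "t < N"
      using RP[OF that] by (simp add: field_simps)
    have unique: "a * ?H + b * ?R = Bbar \<longleftrightarrow> b = \<alpha>" if "t < N" for b
      unfolding \<alpha>_eq[OF that] using RP[OF that] by (auto simp: field_simps)
    have optimal: "optimal_allocation Z m n F Bbar A \<longleftrightarrow>
        (\<forall>s\<in>{1..N}. A (cost F s) = threshold_rule F a t \<alpha> s)" for A
    proof -
      have "optimal_allocation Z m n F Bbar A \<longleftrightarrow>
          (\<forall>c\<in>?C. A c = (if c \<le> cost F t then a else \<alpha> / sqrt c))"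
        using cutoff_rule_optimal[OF fin pos m n cutoff k(3)] by (simp add: mass a_def \<alpha>_def)
      also have "\<dots> \<longleftrightarrow> (\<forall>s\<in>{1..N}. A (cost F s) = threshold_rule F a t \<alpha> s)"
        unfolding C using threshold_rule_cost[OF fin pos t[unfolded N_def]] by (simp add: N_def)
      finally show ?thesis .
    qed
    have steps: "search_steps F Bbar (search N) \<le> time N"
      unfolding search_def time_def by (rule search_from_steps)
    show "\<exists>Abar tstar \<alpha>.
           tstar \<le> card (set_pmf F) \<and>
           (\<forall>A. optimal_allocation Z m n F Bbar A \<longleftrightarrow>
                (\<forall>t\<in>{1..card (set_pmf F)}. A (cost F t) = threshold_rule F Abar tstar \<alpha> t)) \<and>
           threshold_spend F Abar tstar \<alpha> = Bbar \<and>
           (tstar < card (set_pmf F) \<longrightarrow>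
              (\<forall>a. threshold_spend F Abar tstar a = Bbar \<longleftrightarrow> a = \<alpha>) \<and>
              \<alpha> = (Bbar - Abar * head_cost F tstar) / tail_sqrt_cost F tstar) \<and>
           search_output F Bbar (search (card (set_pmf F))) = (Abar, tstar) \<and>
           search_steps F Bbar (search (card (set_pmf F))) \<le> time (card (set_pmf F))"
      unfolding N_def[symmetric]
    proof (rule exI[of _ a], rule exI[of _ t], rule exI[of _ \<alpha>], intro conjI allI impI)
      show "t \<le> N" "search_output F Bbar (search N) = (a, t)" "search_steps F Bbar (search N) \<le> time N"
        by (fact t result steps)+
      show "threshold_spend F a t \<alpha> = Bbar"
        unfolding spend by (rule binding)
      show "threshold_spend F a t b = Bbar \<longleftrightarrow> b = \<alpha>" if "t < N" for b
        unfolding spend by (rule unique[OF that])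
    qed (fact optimal \<alpha>_eq)+
  qed
qed

end
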